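(* In the setting described in the context, let $(x_i,G(x_i,\omega_{i+1}))_{i=0}^N$ be the trajectory of a stochastic algorithm with search points $x_i\in X$ such that $x_i$ depends only on $\{(x_{j-1},\omega_j),\ j=1,\dots,i\}$, and let $\widehat x_N=N^{-1}\sum_{i=1}^Nx_i$. Let $0<\tau\le N/\upsilon^2$ (only $\tau>0$ is required if $\upsilon=0$) and let $y_i=y_i(\tau)$, $i=1,\dots,N$, be the truncated stochastic gradients $$y_i=\begin{cases}G(x_{i-1},\omega_i)&\text{if }\|G(x_{i-1},\omega_i)-g(\bar x)\|_*\le L\|\bar x-x_{i-1}\|+\lambda+\upsilon\sigma,\\ g(\bar x)&\text{otherwise,}\end{cases}$$ with threshold $\lambda=\lambda(\tau)=\max\left\{\sigma\sqrt{N/\tau},\,M\right\}+\upsilon\sigma$. Then for any $t\ge L$ the value $$\Delta_N(\tau,t)=\widehat\epsilon_N(t)+\bar\rho_N(\tau)/N$$ is an upper bound for $\epsilon_N(t)$ with probability at least $1-2e^{-\tau}$, so that $$\mathrm{Prob}\{F(\widehat x_N)-F_*\le\Delta_N(\tau,t)\}\ge1-2e^{-\tau}.$$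
   Context: **Problem.** $E$ is a finite-dimensional real vector space with norm $\|\cdot\|$; $E^*$ is its dual, $\langle s,x\rangle$ is the value of $s\in E^*$ at $x\in E$, and $\|s\|_*=\max\{\langle s,x\rangle:\|x\|\le1\}$. $X\subset E$ is a nonempty convex compact set. $\omega$ is a random variable on $\Omega$ with distribution $P$, $\Phi:X\times\Omega\to\mathbf R$, and $\phi(x)=\mathbf E\{\Phi(x,\omega)\}$ is finite for all $x\in X$, convex on $X$, differentiable at each point of $X$, with $\|\nabla\phi(x')-\nabla\phi(x)\|_*\le L\|x-x'\|$ for all $x,x'\in X$ ($L>0$ a constant). $\psi$ is convex and continuous on $X$. Put $F=\phi+\psi$ and $F_*=\min_{x\in X}F(x)$. **Oracle.** $G:X\times\Omega\to E^*$ satisfies, for all $x\in X$, $\mathbf E\{G(x,\omega)\}=\nabla\phi(x)$ and $\mathbf E\{\|G(x,\omega)-\nabla\phi(x)\|_*^2\}\le\sigma^2$ with a constant $\sigma>0$. A point $\bar x\in X$ and a vector $g(\bar x)\in E^*$ are given with $\|g(\bar x)-\nabla\phi(\bar x)\|_*\le\upsilon\sigma$, $\upsilon\ge0$ a constant. $\omega_1,\omega_2,\dots$ are i.i.d. with distribution $P$. **Proxy function.** $B=\{x\in E:\|x\|\le1\}$; $\theta:B\to\mathbf R$ is continuous and convex; $\theta'(\cdot)$ is a continuous selection of subgradients of $\theta$ on $B^o=\{x\in B:\partial\theta(x)\ne\emptyset\}$, with $\langle\theta'(x)-\theta'(x'),x-x'\rangle\ge\|x-x'\|^2$ for all $x,x'$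 where $\theta'$ is defined; $0=\mathrm{argmin}_{x\in B}\theta(x)$; $\Theta=\max_B\theta-\min_B\theta$ (so $\Theta\ge\frac12$). Let $x_0\in X$ (the starting point of the algorithm, deterministic) and $R>0$ be such that $\max_{x\in X}\|x-x_0\|\le R$. Put $\vartheta(x)=R^2\theta((x-x_0)/R)$, $\vartheta'(x)=R\,\theta'((x-x_0)/R)$, and $V_x(z)=\vartheta(z)-\vartheta(x)-\langle\vartheta'(x),z-x\rangle$ for $z,x\in X$ (the search points $x_i$ at which $V_{x_i}$ is used are such that $\vartheta'(x_i)$ is defined). Put $M=LR$. **Accuracy certificates.** $$\epsilon_N(t)=N^{-1}\sup_{z\in X}\sum_{i=1}^N\left[\langle\nabla\phi(x_{i-1}),x_i-z\rangle+\psi(x_i)-\psi(z)+tV_{x_{i-1}}(x_i)\right],$$ $$\widehat\epsilon_N(t)=N^{-1}\sup_{z\in X}\sum_{i=1}^N\left[\langle y_i,x_i-z\rangle+\psi(x_i)-\psi(z)+tV_{x_{i-1}}(x_i)\right],$$ $$\bar\rho_N(\tau)=4R\sqrt{5\Theta\max\{N\sigma^2,M^2\tau\}}+16R\max\{\sigma\sqrt{N\tau},M\tau\}+\inf_{\mu>0}\left\{20\mu\max\{N\sigma^2,M^2\tau\}+\mu^{-1}\sum_{i=1}^NV_{x_{i-1}}(x_i)\right\}.$$ *)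

theory Defs
  imports "HOL-Probability.Probability"
begin

text \<open>
  The class of finite-dimensional real normed spaces with an arbitrary norm. Bochner integrals of
  functions with values in the dual \<open>'a \<Rightarrow>\<^sub>L real\<close> need the dual to be second countable, whence the
  instances below. The dual norm is the operator norm on \<open>'a \<Rightarrow>\<^sub>L real\<close>.
\<close>

class finite_dim_normed_space = real_normed_vector +
  assumes finite_dim: "\<exists>B. finite B \<and> (\<forall>x. \<exists>u. x = (\<Sum>b\<in>B. u b *\<^sub>R b))"

lemma finite_spanning_set:
  "\<exists>B :: 'a::finite_dim_normed_space set. finite B \<and> span B = UNIV"
proof -
  obtain B :: "'a set" where B: "finite B" "\<And>x. \<exists>u. x = (\<Sum>b\<in>B. u b *\<^sub>R b)"
    using finite_dim by blast
  then show ?thesis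
    by (intro exI[of _ B]) (auto simp: span_finite image_iff)
qed

lemma finite_dimI:
  assumes "finite (B :: 'a::real_vector set)" "span B = UNIV"
  shows "\<exists>B :: 'a set. finite B \<and> (\<forall>x. \<exists>u. x = (\<Sum>b\<in>B. u b *\<^sub>R b))"
  using assms by (intro exI[of _ B]) (auto simp: span_finite set_eq_iff image_iff)

lemma real_span_sum_approx:
  fixes x :: "'a::real_normed_vector"
  assumes "finite B" "x \<in> span B" "e > 0"
  shows "\<exists>q\<in>B \<rightarrow>\<^sub>E \<rat>. norm (x - (\<Sum>b\<in>B. q b *\<^sub>R b)) < e"
proof -
  obtain u where u: "x = (\<Sum>b\<in>B. u b *\<^sub>R b)"
    using assms(1,2) by (auto simp: span_finite)
  define d where "d = e / (1 + (\<Sum>b\<in>B. norm b))"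
  have pos: "1 + (\<Sum>b\<in>B. norm b) > 0"
    by (simp add: add_pos_nonneg sum_nonneg)
  have "d > 0"
    using pos assms(3) by (simp add: d_def)
  have "\<exists>r\<in>\<rat>. \<bar>u b - r\<bar> < d" for b
  proof -
    obtain r where "r \<in> \<rat>" "u b - d < r" "r < u b"
      using Rats_dense_in_real[of "u b - d" "u b"] \<open>d > 0\<close> by auto
    then show ?thesis
      by (intro bexI[of _ r]) auto
  qed
  then obtain q where q: "\<And>b. q b \<in> \<rat>" "\<And>b. \<bar>u b - q b\<bar> < d"
    by metis
  have "norm (x - (\<Sum>b\<in>B. q b *\<^sub>R b)) = norm (\<Sum>b\<in>B. (u b - q b) *\<^sub>R b)"
    by (simp add: u sum_subtractf scaleR_left_diff_distrib)
  also have "\<dots> \<le> (\<Sum>b\<in>B. d * norm b)"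
    using less_imp_le[OF q(2)] by (intro sum_norm_le) (auto intro!: mult_right_mono)
  also have "\<dots> = d * (\<Sum>b\<in>B. norm b)"
    by (simp add: sum_distrib_left)
  also have "\<dots> < d * (1 + (\<Sum>b\<in>B. norm b))"
    using \<open>d > 0\<close> by simp
  also have "\<dots> = e"
    using pos by (simp add: d_def)
  finally show ?thesis
    using q(1) by (intro bexI[of _ "restrict q B"]) auto
qed

instance finite_dim_normed_space \<subseteq> second_countable_topology
proof
  obtain B :: "'a set" where B: "finite B" "span B = UNIV"
    using finite_spanning_set by blast
  define D where "D = (\<lambda>q. \<Sum>b\<in>B. q b *\<^sub>R b) ` (B \<rightarrow>\<^sub>E \<rat>)"
  define K where "K = (\<lambda>(d, n). ball d (1 / real (Suc n))) ` (D \<times> (UNIV :: nat set))"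
  have "countable D"
    unfolding D_def by (intro countable_image countable_PiE B countable_rat)
  then have "countable K"
    by (auto simp: K_def)
  have dense: "\<exists>d\<in>D. dist x d < e" if "e > 0" for x :: 'a and e :: real
    using real_span_sum_approx[OF B(1), of x e] B(2) that by (auto simp: D_def dist_norm)
  have "topological_basis K"
  proof (rule topological_basisI)
    fix U :: "'a set" and x :: 'a
    assume "open U" "x \<in> U"
    then obtain e where e: "e > 0" "ball x e \<subseteq> U"
      using open_contains_ball by blast
    obtain n where n: "1 / real (Suc n) < e / 2"
      using e(1) nat_approx_posE[of "e / 2"] by auto
    obtain d where d: "d \<in> D" "dist x d < 1 / real (Suc n)"
      using dense[of "1 / real (Suc n)" x] by auto
    have "ball d (1 / real (Suc n)) \<subseteq> ball x e"
    proof
      fix z assume "z \<in> ball d (1 / real (Suc n))"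
      then show "z \<in> ball x e"
        using dist_triangle[of x z d] n d(2) by (simp add: dist_commute)
    qed
    then show "\<exists>V\<in>K. x \<in> V \<and> V \<subseteq> U"
      using d e(2) by (intro bexI[of _ "ball d (1 / real (Suc n))"]) (auto simp: K_def dist_commute)
  qed (auto simp: K_def)
  then show "\<exists>K::'a set set. countable K \<and> open = generate_topology K"
    using \<open>countable K\<close> topological_basis_imp_subbasis by blast
qed

instance euclidean_space \<subseteq> finite_dim_normed_space
  by standard (rule finite_dimI[OF finite_Basis span_Basis])

lemma finite_spanning_set_real_dual:
  "\<exists>C :: ('a::finite_dim_normed_space \<Rightarrow>\<^sub>L real) set. finite C \<and> span C = UNIV"
proof -
  obtain B0 :: "'a set" where B0: "finite B0" "span B0 = UNIV"
    using finite_spanning_set by blast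
  obtain B where B: "B \<subseteq> B0" "independent B" "B0 \<subseteq> span B"
    using maximal_independent_subset[of B0] by blast
  have fB: "finite B"
    using B(1) B0(1) finite_subset by blast
  have sB: "span B = UNIV"
    using B(3) B0(2) by (metis span_mono span_span top.extremum_uniqueI)
  define T where "T f = (\<Sum>b\<in>B. blinfun_apply f b *\<^sub>R b)" for f :: "'a \<Rightarrow>\<^sub>L real"
  have "linear T"
    by (intro linearI)
      (auto simp: T_def blinfun.bilinear_simps scaleR_left_distrib sum.distrib scaleR_sum_right)
  have "f = 0" if "T f = 0" for f
  proof -
    have "blinfun_apply f b = 0" if "b \<in> B" for b
      using independentD[OF B(2) fB order_refl, of "blinfun_apply f" b] that \<open>T f = 0\<close>
      by (simp add: T_def)
    then have "blinfun_apply f x = 0" for x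
      using linear_eq_0_on_span[OF bounded_linear.linear[OF blinfun.bounded_linear_right[of f]], of B x] sB
      by simp
    then show ?thesis
      by (simp add: blinfun_eqI)
  qed
  then have "inj T"
    by (simp add: linear_injective_0[OF \<open>linear T\<close>])
  obtain C where C: "independent C" "(UNIV :: ('a \<Rightarrow>\<^sub>L real) set) \<subseteq> span C"
    by (rule maximal_independent_subset[of UNIV])
  have "independent (T ` C)"
    using linear_independent_injective_image[OF \<open>linear T\<close> C(1)] inj_on_subset[OF \<open>inj T\<close> subset_UNIV]
    by simp
  then have "finite (T ` C)"
    using independent_span_bound[OF fB, of "T ` C"] sB by simp
  then have "finite C"
    by (rule finite_imageD) (rule inj_on_subset[OF \<open>inj T\<close> subset_UNIV])
  then show ?thesis
    using C(2) by (intro exI[of _ C] conjI top.extremum_uniqueI)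
qed

instance blinfun :: (finite_dim_normed_space, euclidean_space) finite_dim_normed_space
proof
  obtain C :: "('a \<Rightarrow>\<^sub>L real) set" where C: "finite C" "span C = UNIV"
    using finite_spanning_set_real_dual by blast
  define h where "h e g = blinfun_scaleR_left e o\<^sub>L g" for e :: 'b and g :: "'a \<Rightarrow>\<^sub>L real"
  define K where "K = (\<lambda>(e, c). h e c) ` (Basis \<times> C)"
  have "f \<in> span K" for f :: "'a \<Rightarrow>\<^sub>L 'b"
  proof -
    have h_span: "h e g \<in> span K" if "e \<in> Basis" for e g
    proof -
      have lin: "linear (h e)"
        by (intro linearI) (auto simp: h_def blinfun_eqI blinfun.bilinear_simps scaleR_left_distrib
            intro!: blinfun_eqI)
      have "h e g \<in> span (h e ` C)"
        using linear_span_image[OF lin, of C] C(2) by auto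
      also have "\<dots> \<subseteq> span K"
        using that by (intro span_mono) (auto simp: K_def)
      finally show ?thesis .
    qed
    have "f = (\<Sum>e\<in>Basis. h e (blinfun_inner_left e o\<^sub>L f))"
      by (intro blinfun_eqI) (simp add: h_def blinfun.sum_left euclidean_representation)
    also have "\<dots> \<in> span K"
      by (intro span_sum h_span)
    finally show ?thesis .
  qed
  moreover have "finite K"
    using C(1) by (simp add: K_def)
  ultimately show "\<exists>K :: ('a \<Rightarrow>\<^sub>L 'b) set. finite K \<and> (\<forall>f. \<exists>u. f = (\<Sum>k\<in>K. u k *\<^sub>R k))"
    by (intro finite_dimI[of K]) auto
qed

definition subdifferential ::
    "'a::real_normed_vector set \<Rightarrow> ('a \<Rightarrow> real) \<Rightarrow> 'a \<Rightarrow> ('a \<Rightarrow>\<^sub>L real) set" where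
  "subdifferential C f x = {s. \<forall>z\<in>C. f x + blinfun_apply s (z - x) \<le> f z}"

definition subdiff_domain :: "'a::real_normed_vector set \<Rightarrow> ('a \<Rightarrow> real) \<Rightarrow> 'a set" where
  "subdiff_domain C f = {x\<in>C. subdifferential C f x \<noteq> {}}"

definition proxy_function ::
    "('a::real_normed_vector \<Rightarrow> real) \<Rightarrow> ('a \<Rightarrow> 'a \<Rightarrow>\<^sub>L real) \<Rightarrow> bool" where
  "proxy_function \<theta> \<theta>' \<longleftrightarrow>
     continuous_on (cball 0 1) \<theta> \<and>
     convex_on (cball 0 1) \<theta> \<and>
     continuous_on (subdiff_domain (cball 0 1) \<theta>) \<theta>' \<and>
     (\<forall>x\<in>subdiff_domain (cball 0 1) \<theta>. \<theta>' x \<in> subdifferential (cball 0 1) \<theta> x) \<and>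
     (\<forall>x\<in>subdiff_domain (cball 0 1) \<theta>. \<forall>x'\<in>subdiff_domain (cball 0 1) \<theta>.
        blinfun_apply (\<theta>' x - \<theta>' x') (x - x') \<ge> (norm (x - x'))\<^sup>2) \<and>
     is_arg_min \<theta> (\<lambda>x. x \<in> cball 0 1) 0"

definition proxy_range :: "('a::real_normed_vector \<Rightarrow> real) \<Rightarrow> real" where
  "proxy_range \<theta> = (SUP x\<in>cball 0 1. \<theta> x) - (INF x\<in>cball 0 1. \<theta> x)"

definition scaled_proxy ::
    "real \<Rightarrow> 'a::real_normed_vector \<Rightarrow> ('a \<Rightarrow> real) \<Rightarrow> 'a \<Rightarrow> real" where
  "scaled_proxy R x0 \<theta> x = R\<^sup>2 * \<theta> ((x - x0) /\<^sub>R R)"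

definition scaled_proxy_grad ::
    "real \<Rightarrow> 'a::real_normed_vector \<Rightarrow> ('a \<Rightarrow> 'a \<Rightarrow>\<^sub>L real) \<Rightarrow> 'a \<Rightarrow> 'a \<Rightarrow>\<^sub>L real" where
  "scaled_proxy_grad R x0 \<theta>' x = R *\<^sub>R \<theta>' ((x - x0) /\<^sub>R R)"

text \<open>\<open>bregman R x0 \<theta> \<theta>' x z\<close> is the divergence \<open>V\<^sub>x(z)\<close> of \<open>z\<close> from the base point \<open>x\<close>.\<close>

definition bregman ::
    "real \<Rightarrow> 'a::real_normed_vector \<Rightarrow> ('a \<Rightarrow> real) \<Rightarrow> ('a \<Rightarrow> 'a \<Rightarrow>\<^sub>L real) \<Rightarrow> 'a \<Rightarrow> 'a \<Rightarrow> real" where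
  "bregman R x0 \<theta> \<theta>' x z =
     scaled_proxy R x0 \<theta> z - scaled_proxy R x0 \<theta> x
       - blinfun_apply (scaled_proxy_grad R x0 \<theta>' x) (z - x)"

text \<open>
  The search point \<open>x i\<close> is a (measurable) function of the pairs \<open>(x (j - 1), \<omega> j)\<close> with
  \<open>1 \<le> j \<le> i\<close>. For \<open>i = 0\<close> there are no such pairs and the point is the deterministic \<open>x0\<close>.
\<close>

definition search_points ::
    "'s measure \<Rightarrow> 'w measure \<Rightarrow> (nat \<Rightarrow> 's \<Rightarrow> 'w) \<Rightarrow> 'a::topological_space set \<Rightarrow> 'a \<Rightarrow> nat
      \<Rightarrow> (nat \<Rightarrow> 's \<Rightarrow> 'a) \<Rightarrow> bool" where
  "search_points S P \<omega> X x0 N x \<longleftrightarrow>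
     (\<forall>s\<in>space S. x 0 s = x0) \<and>
     (\<forall>i\<le>N. \<forall>s\<in>space S. x i s \<in> X) \<and>
     (\<forall>i\<in>{1..N}. \<exists>A \<in> measurable (PiM {1..i} (\<lambda>_. borel \<Otimes>\<^sub>M P)) borel.
        \<forall>s\<in>space S. x i s = A (\<lambda>j\<in>{1..i}. (x (j - 1) s, \<omega> j s)))"

definition threshold :: "real \<Rightarrow> real \<Rightarrow> real \<Rightarrow> nat \<Rightarrow> real \<Rightarrow> real" where
  "threshold \<sigma> M \<upsilon> N \<tau> = max (\<sigma> * sqrt (real N / \<tau>)) M + \<upsilon> * \<sigma>"

definition truncated_grad ::
    "real \<Rightarrow> real \<Rightarrow> real \<Rightarrow> real \<Rightarrow> 'a::real_normed_vector \<Rightarrow> 'a \<Rightarrow>\<^sub>L real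
      \<Rightarrow> 'a \<Rightarrow> 'a \<Rightarrow>\<^sub>L real \<Rightarrow> 'a \<Rightarrow>\<^sub>L real" where
  "truncated_grad L lev \<sigma> \<upsilon> xbar gbar x u =
     (if norm (u - gbar) \<le> L * norm (xbar - x) + lev + \<upsilon> * \<sigma> then u else gbar)"

text \<open>
  The two certificates of a trajectory \<open>x\<close> differ only in the linear forms used: \<open>g i\<close> is the exact
  gradient at \<open>x (i - 1)\<close> for \<open>\<epsilon>\<^sub>N(t)\<close>, and the truncated stochastic gradient \<open>y\<^sub>i\<close> for its
  observable counterpart.
\<close>

definition certificate ::
    "'a::real_normed_vector set \<Rightarrow> ('a \<Rightarrow> real) \<Rightarrow> ('a \<Rightarrow> 'a \<Rightarrow> real) \<Rightarrow> nat \<Rightarrow> real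
      \<Rightarrow> (nat \<Rightarrow> 'a \<Rightarrow>\<^sub>L real) \<Rightarrow> (nat \<Rightarrow> 'a) \<Rightarrow> real" where
  "certificate X \<psi> V N t g x =
     (SUP z\<in>X. \<Sum>i=1..N. blinfun_apply (g i) (x i - z) + \<psi> (x i) - \<psi> z + t * V (x (i - 1)) (x i))
       / real N"

definition rho_bar ::
    "real \<Rightarrow> real \<Rightarrow> real \<Rightarrow> real \<Rightarrow> ('a \<Rightarrow> 'a \<Rightarrow> real) \<Rightarrow> nat \<Rightarrow> real \<Rightarrow> (nat \<Rightarrow> 'a) \<Rightarrow> real" where
  "rho_bar R \<Theta> \<sigma> M V N \<tau> x =
     4 * R * sqrt (5 * \<Theta> * max (real N * \<sigma>\<^sup>2) (M\<^sup>2 * \<tau>))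
     + 16 * R * max (\<sigma> * sqrt (real N * \<tau>)) (M * \<tau>)
     + (INF \<mu>\<in>{0<..}. 20 * \<mu> * max (real N * \<sigma>\<^sup>2) (M\<^sup>2 * \<tau>)
          + inverse \<mu> * (\<Sum>i=1..N. V (x (i - 1)) (x i)))"

definition Delta ::
    "'a::real_normed_vector set \<Rightarrow> ('a \<Rightarrow> real) \<Rightarrow> ('a \<Rightarrow> 'a \<Rightarrow> real) \<Rightarrow> real \<Rightarrow> real \<Rightarrow> real \<Rightarrow> real
      \<Rightarrow> nat \<Rightarrow> real \<Rightarrow> real \<Rightarrow> (nat \<Rightarrow> 'a \<Rightarrow>\<^sub>L real) \<Rightarrow> (nat \<Rightarrow> 'a) \<Rightarrow> real" where
  "Delta X \<psi> V R \<Theta> \<sigma> M N \<tau> t y x =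
     certificate X \<psi> V N t y x + rho_bar R \<Theta> \<sigma> M V N \<tau> x / real N"

end

theory Submission
  imports Defs
begin

text \<open>
  The exact and the observable certificate are suprema over \<open>z \<in> X\<close> of two expressions whose difference
  is the linear error \<open>\<Sum>\<^sub>i \<langle>\<xi>\<^sub>i, z - x\<^sub>i\<rangle>\<close>, where \<open>\<xi>\<^sub>i = y\<^sub>i - \<nabla>\<phi>(x\<^sub>i\<^sub>-\<^sub>1)\<close>. Since the exact certificate
  always dominates the optimality gap (\<open>certificate_bounds_gap\<close>), both claims follow once the linear
  error is at most \<open>rho_bar\<close>, simultaneously for all \<open>z\<close>, outside an event of probability
  \<open>2 exp (-\<tau>)\<close> (\<open>certificate_compare\<close>).

  The difficulty is that the maximising \<open>z\<close> depends on all the noise. With \<open>u = (z - x\<^sub>0) / R\<close>,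
  \<open>\<langle>\<xi>\<^sub>i, z - x\<^sub>i\<rangle> = R \<langle>\<xi>\<^sub>i, u - v\<^sub>i\<^sub>-\<^sub>1\<rangle> + \<langle>\<xi>\<^sub>i, x\<^sub>0 + R v\<^sub>i\<^sub>-\<^sub>1 - x\<^sub>i\<^sub>-\<^sub>1\<rangle> + \<langle>\<xi>\<^sub>i, x\<^sub>i\<^sub>-\<^sub>1 - x\<^sub>i\<rangle>\<close>,
  where \<open>v\<^sub>i\<close> maximises \<open>\<eta> \<langle>\<xi>\<^sub>1 + \<dots> + \<xi>\<^sub>i, v\<rangle> - \<theta> v\<close> over the unit ball: dual averaging run on the noise
  itself. Its regret bound (\<open>dual_averaging_regret\<close>) estimates the first sum uniformly in \<open>u\<close> by
  \<open>\<Theta> / \<eta> + \<eta> / 2 \<Sum>\<^sub>i \<parallel>\<xi>\<^sub>i\<parallel>\<^sup>2\<close>. In the second sum, \<open>v\<^sub>i\<^sub>-\<^sub>1\<close> and \<open>x\<^sub>i\<^sub>-\<^sub>1\<close> are functions of the past only, so it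
  is a martingale apart from the bias caused by truncation. Young's inequality splits the third sum into
  a multiple of \<open>\<Sum>\<^sub>i \<parallel>\<xi>\<^sub>i\<parallel>\<^sup>2\<close> and the divergences that occur in \<open>rho_bar\<close>. Hence only \<open>\<Sum>\<^sub>i \<parallel>\<xi>\<^sub>i\<parallel>\<^sup>2\<close> and
  the second sum are random quantities to control, and each costs one tail \<open>exp (-\<tau>)\<close>.

  Both tails come from \<open>adapted_sum_tail\<close>, which asks for one conditional exponential moment per step.
  Put \<open>l = max (\<sigma> \<surd>(N / \<tau>)) M\<close> and \<open>k = \<upsilon> \<sigma>\<close>; the restriction on \<open>\<tau>\<close> gives \<open>k \<le> l\<close>, and the threshold is
  \<open>l + k\<close>. A truncated noise vector is bounded by \<open>5 l + 3 k\<close>, is at most \<open>(2 l + k) / (l + k)\<close> times the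
  original one, and its bias is quadratic in the original one, because truncation happens only if the
  original exceeds \<open>l + k\<close> (\<open>truncated_noise_moments\<close>). As \<open>N \<sigma>\<^sup>2 \<le> \<tau> l\<^sup>2\<close>, this gives
  \<open>\<Sum>\<^sub>i \<parallel>\<xi>\<^sub>i\<parallel>\<^sup>2 \<le> 40 \<tau> l\<^sup>2\<close> and bounds the second sum by \<open>16 R \<tau> l\<close>. Since \<open>\<tau> l\<^sup>2 = max (N \<sigma>\<^sup>2) (M\<^sup>2 \<tau>)\<close>, the
  choice \<open>\<eta> = \<surd>(\<Theta> / (20 \<tau> l\<^sup>2))\<close> turns the three estimates into the three terms of \<open>rho_bar\<close>
  (\<open>linear_error_le_rho_bar\<close>).

  Dual averaging needs \<open>\<theta>\<close> to be strongly convex on the whole ball, whereas the hypothesis only speaks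
  about a selection of subgradients where there are any. That every point of the open ball has a
  subgradient (\<open>ball_subset_subdiff_domain\<close>) is obtained by minimising the conjugate minus evaluation at
  that point over the finite-dimensional dual; strong convexity follows there and extends to the sphere by continuity.
\<close>

section \<open>Finite-dimensional normed spaces\<close>

lemma compact_bounded_coefficients:
  fixes B :: "'a::real_normed_vector set"
  assumes "finite B"
  shows "compact {(\<Sum>b\<in>B. u b *\<^sub>R b) |u. \<forall>b\<in>B. \<bar>u b\<bar> \<le> r}"
  using assms
proof (induction B)
  case empty
  then show ?case by simp
next
  case (insert b B)
  let ?K = "\<lambda>B. {(\<Sum>b\<in>B. u b *\<^sub>R b) |u. \<forall>b\<in>B. \<bar>u b\<bar> \<le> r}"
  have "?K (insert b B) = {v + w |v w. v \<in> (\<lambda>c. c *\<^sub>R b) ` {-r..r} \<and> w \<in> ?K B}"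
  proof (intro equalityI subsetI)
    fix v assume "v \<in> ?K (insert b B)"
    then obtain u where u: "v = (\<Sum>b\<in>insert b B. u b *\<^sub>R b)" "\<forall>b\<in>insert b B. \<bar>u b\<bar> \<le> r" by blast
    have "u b \<in> {-r..r}" using u(2) by auto
    then show "v \<in> {v + w |v w. v \<in> (\<lambda>c. c *\<^sub>R b) ` {-r..r} \<and> w \<in> ?K B}"
      using u insert.hyps
      by (intro CollectI exI[of _ "u b *\<^sub>R b"] exI[of _ "\<Sum>b\<in>B. u b *\<^sub>R b"]) auto
  next
    fix v assume "v \<in> {v + w |v w. v \<in> (\<lambda>c. c *\<^sub>R b) ` {-r..r} \<and> w \<in> ?K B}"
    then obtain c u where u: "v = c *\<^sub>R b + (\<Sum>b\<in>B. u b *\<^sub>R b)" "\<forall>b\<in>B. \<bar>u b\<bar> \<le> r" "\<bar>c\<bar> \<le> r"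
      by auto
    have "(\<Sum>b\<in>B. u b *\<^sub>R b) = (\<Sum>d\<in>B. (u(b := c)) d *\<^sub>R d)"
      using insert.hyps by (intro sum.cong) auto
    then have "v = (\<Sum>d\<in>insert b B. (u(b := c)) d *\<^sub>R d)"
      using u(1) insert.hyps by simp
    moreover have "\<forall>d\<in>insert b B. \<bar>(u(b := c)) d\<bar> \<le> r" using u by auto
    ultimately show "v \<in> ?K (insert b B)" by blast
  qed
  also have "compact \<dots>"
    by (rule compact_sums[OF compact_continuous_image insert.IH]) (auto intro!: continuous_intros)
  finally show ?case .
qed

text \<open>
  A new vector \<open>b\<close> outside the span of \<open>B\<close> has positive distance from that span: candidates for a nearest
  point have bounded coefficients by induction, so they range over a compact set. This distance bounds
  the coefficient of \<open>b\<close>, and induction bounds the others.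
\<close>

lemma bounded_coefficients:
  fixes B :: "'a::real_normed_vector set"
  assumes "finite B"
  shows "\<exists>C. \<forall>x\<in>span B. \<exists>u. x = (\<Sum>b\<in>B. u b *\<^sub>R b) \<and> (\<forall>b\<in>B. \<bar>u b\<bar> \<le> C * norm x)"
  using assms
proof (induction B)
  case empty
  then show ?case by simp
next
  case (insert b B)
  then obtain C where C: "\<And>x. x \<in> span B \<Longrightarrow>
      \<exists>u. x = (\<Sum>b\<in>B. u b *\<^sub>R b) \<and> (\<forall>b\<in>B. \<bar>u b\<bar> \<le> C * norm x)"
    by blast
  have extend: "(\<Sum>d\<in>insert b B. (u(b := c)) d *\<^sub>R d) = c *\<^sub>R b + (\<Sum>d\<in>B. u d *\<^sub>R d)" for u c
  proof -
    have "(\<Sum>d\<in>B. (u(b := c)) d *\<^sub>R d) = (\<Sum>d\<in>B. u d *\<^sub>R d)"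
      using insert.hyps by (intro sum.cong) auto
    then show ?thesis using insert.hyps by simp
  qed
  show ?case
  proof (cases "b \<in> span B")
    case True
    then have "span (insert b B) = span B" by (rule span_redundant)
    moreover have "\<exists>u. x = (\<Sum>b\<in>insert b B. u b *\<^sub>R b) \<and> (\<forall>d\<in>insert b B. \<bar>u d\<bar> \<le> max 0 C * norm x)"
      if x: "x \<in> span B" for x
    proof -
      obtain u where u: "x = (\<Sum>b\<in>B. u b *\<^sub>R b)" "\<forall>b\<in>B. \<bar>u b\<bar> \<le> C * norm x"
        using C[OF x] by blast
      have "C * norm x \<le> max 0 C * norm x" by (intro mult_right_mono) auto
      then show ?thesis using u extend[of u 0] by (intro exI[of _ "u(b := 0)"]) force
    qed
    ultimately show ?thesis by blast
  next
    case False
    obtain d where d: "d > 0" "\<And>y. y \<in> span B \<Longrightarrow> norm (b - y) \<ge> d"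
    proof -
      let ?K = "{(\<Sum>b\<in>B. u b *\<^sub>R b) |u. \<forall>e\<in>B. \<bar>u e\<bar> \<le> max 0 C * (norm b + 1)}"
      have "?K \<noteq> {}" by (auto intro!: exI[of _ "\<lambda>_. 0"])
      moreover have "continuous_on ?K (\<lambda>y. norm (b - y))" by (intro continuous_intros)
      ultimately obtain y0 where y0: "y0 \<in> ?K" "\<And>y. y \<in> ?K \<Longrightarrow> norm (b - y0) \<le> norm (b - y)"
        using continuous_attains_inf[OF compact_bounded_coefficients[OF insert.hyps(1)],
            of "max 0 C * (norm b + 1)" "\<lambda>y. norm (b - y)"] by blast
      have "y0 \<in> span B" using y0(1) by (auto intro!: span_sum span_scale intro: span_base)
      then have pos: "norm (b - y0) > 0" using False by auto
      have "min 1 (norm (b - y0)) \<le> norm (b - y)" if y: "y \<in> span B" for y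
      proof (rule ccontr)
        assume less: "\<not> min 1 (norm (b - y0)) \<le> norm (b - y)"
        have "norm y \<le> norm b + norm (b - y)" by (metis add.commute norm_minus_commute norm_triangle_sub)
        then have "norm y \<le> norm b + 1" using less by linarith
        then have "C * norm y \<le> max 0 C * (norm b + 1)" by (intro mult_mono) auto
        then have "y \<in> ?K" using C[OF y] by force
        then show False using y0(2) less by fastforce
      qed
      then show thesis using that[of "min 1 (norm (b - y0))"] pos by auto
    qed
    have coef: "\<bar>c\<bar> \<le> norm (c *\<^sub>R b + y) / d" if "y \<in> span B" for c y
    proof (cases "c = 0")
      case True
      then show ?thesis using d(1) by simp
    next
      case False
      have "\<bar>c\<bar> * d \<le> \<bar>c\<bar> * norm (b - (- inverse c) *\<^sub>R y)"
        using that by (intro mult_left_mono d(2) span_scale) auto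
      also have "\<dots> = norm (c *\<^sub>R (b - (- inverse c) *\<^sub>R y))"
        by simp
      also have "\<dots> = norm (c *\<^sub>R b + y)"
        using False by (simp add: scaleR_right_distrib)
      finally show ?thesis using False d(1) by (simp add: field_simps)
    qed
    define C' where "C' = max 0 C * (1 + norm b / d)"
    have "\<exists>u. x = (\<Sum>b\<in>insert b B. u b *\<^sub>R b) \<and> (\<forall>e\<in>insert b B. \<bar>u e\<bar> \<le> max (1 / d) C' * norm x)"
      if x: "x \<in> span (insert b B)" for x
    proof -
      obtain c where c: "x - c *\<^sub>R b \<in> span B" using x by (auto simp: span_insert)
      define y where "y = x - c *\<^sub>R b"
      have xy: "x = c *\<^sub>R b + y" by (simp add: y_def)
      obtain u where u: "y = (\<Sum>b\<in>B. u b *\<^sub>R b)" "\<forall>b\<in>B. \<bar>u b\<bar> \<le> C * norm y"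
        using C[OF c] unfolding y_def by blast
      have c_le: "\<bar>c\<bar> \<le> norm x / d" using coef[OF c, of c] by simp
      have "norm y \<le> norm x + \<bar>c\<bar> * norm b"
        unfolding y_def by (metis norm_scaleR norm_triangle_ineq4)
      also have "\<dots> \<le> norm x + norm x / d * norm b"
        using c_le by (intro add_mono mult_right_mono) auto
      also have "\<dots> = (1 + norm b / d) * norm x" by (simp add: algebra_simps)
      finally have "C * norm y \<le> max 0 C * ((1 + norm b / d) * norm x)"
        by (intro mult_mono) auto
      then have "C * norm y \<le> C' * norm x" by (simp add: C'_def mult.assoc)
      also have "\<dots> \<le> max (1 / d) C' * norm x" by (intro mult_right_mono) auto
      finally have 1: "\<forall>e\<in>B. \<bar>u e\<bar> \<le> max (1 / d) C' * norm x" using u(2) by force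
      have "norm x / d \<le> max (1 / d) C' * norm x"
        using mult_right_mono[of "1 / d" "max (1 / d) C'" "norm x"] by simp
      then have 2: "\<bar>c\<bar> \<le> max (1 / d) C' * norm x" using c_le by linarith
      show ?thesis
        using 1 2 u(1) xy extend[of u c] by (intro exI[of _ "u(b := c)"]) auto
    qed
    then show ?thesis by blast
  qed
qed

lemma compact_cball_finite_dim: "compact (cball (0::'a::finite_dim_normed_space) r)"
proof -
  obtain B :: "'a set" where B: "finite B" "span B = UNIV"
    using finite_spanning_set by blast
  obtain C where C: "\<And>x. \<exists>u. x = (\<Sum>b\<in>B. u b *\<^sub>R b) \<and> (\<forall>b\<in>B. \<bar>u b\<bar> \<le> C * norm x)"
    using bounded_coefficients[OF B(1)] B(2) by auto
  let ?K = "{(\<Sum>b\<in>B. u b *\<^sub>R b) |u. \<forall>b\<in>B. \<bar>u b\<bar> \<le> max 0 C * r}"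
  have "cball 0 r \<subseteq> ?K"
  proof
    fix x :: 'a assume "x \<in> cball 0 r"
    then have "C * norm x \<le> max 0 C * r" by (intro mult_mono) auto
    then show "x \<in> ?K" using C[of x] by force
  qed
  then show ?thesis
    using compact_Int_closed[OF compact_bounded_coefficients[OF B(1)] closed_cball[of 0 r], of "max 0 C * r"]
    by (simp add: Int_absorb1)
qed

lemma linear_imp_bounded_linear_finite_dim:
  fixes f :: "'a::finite_dim_normed_space \<Rightarrow> 'b::real_normed_vector"
  assumes "linear f"
  shows "bounded_linear f"
proof -
  obtain B :: "'a set" where B: "finite B" "span B = UNIV"
    using finite_spanning_set by blast
  obtain C where C: "\<And>x. \<exists>u. x = (\<Sum>b\<in>B. u b *\<^sub>R b) \<and> (\<forall>b\<in>B. \<bar>u b\<bar> \<le> C * norm x)"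
    using bounded_coefficients[OF B(1)] B(2) by auto
  have "norm (f x) \<le> norm x * (\<Sum>b\<in>B. C * norm (f b))" for x
  proof -
    obtain u where u: "x = (\<Sum>b\<in>B. u b *\<^sub>R b)" "\<forall>b\<in>B. \<bar>u b\<bar> \<le> C * norm x"
      using C by blast
    have "f x = (\<Sum>b\<in>B. u b *\<^sub>R f b)"
      by (simp add: u(1) linear_sum[OF assms] linear_scale[OF assms])
    also have "norm \<dots> \<le> (\<Sum>b\<in>B. (C * norm x) * norm (f b))"
      using u(2) by (intro sum_norm_le) (auto intro!: mult_right_mono)
    also have "\<dots> = norm x * (\<Sum>b\<in>B. C * norm (f b))"
      by (simp add: sum_distrib_left algebra_simps)
    finally show ?thesis .
  qed
  then show ?thesis
    using assms by (intro bounded_linear_intro[of f]) (auto simp: linear_add linear_scale)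
qed

text \<open>
  Any linear functional that takes the value 1 at \<open>x\<close> will do, as it is bounded in finite dimension.
\<close>

lemma functionals_separate_points:
  fixes x :: "'a::finite_dim_normed_space"
  assumes "\<And>k :: 'a \<Rightarrow>\<^sub>L real. blinfun_apply k x = 0"
  shows "x = 0"
proof (rule ccontr)
  assume "x \<noteq> 0"
  then obtain f :: "'a \<Rightarrow> real" where f: "linear f" "f x = 1"
    using linear_independent_extend[of "{x}" "\<lambda>_. 1::real"] by auto
  have "blinfun_apply (Blinfun f) x = 1"
    using linear_imp_bounded_linear_finite_dim[OF f(1)] f(2) by (simp add: bounded_linear_Blinfun_apply)
  then show False using assms by simp
qed

section \<open>The mirror map of a proxy function\<close>

text \<open>
  Subgradients are characterised by a maximisation problem, so they can be found by compactness.
\<close>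

lemma subdifferential_iff_maximizer:
  "s \<in> subdifferential C f v \<longleftrightarrow> (\<forall>z\<in>C. blinfun_apply s z - f z \<le> blinfun_apply s v - f v)"
  by (auto simp: subdifferential_def blinfun.diff_right algebra_simps)

text \<open>
  The gradient of the convex conjugate of \<open>\<theta>\<close> restricted to the unit ball. For a proxy function there
  is only one point to choose from.
\<close>

definition mirror_map :: "('a::finite_dim_normed_space \<Rightarrow> real) \<Rightarrow> ('a \<Rightarrow>\<^sub>L real) \<Rightarrow> 'a" where
  "mirror_map \<theta> s = (SOME v. v \<in> cball 0 1 \<and> s \<in> subdifferential (cball 0 1) \<theta> v)"

text \<open>
  The convex conjugate of \<open>\<theta>\<close> restricted to the unit ball. Expressing it through the maximiser makes the
  subgradient inequalities for it immediate.
\<close>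

definition conjugate :: "('a::finite_dim_normed_space \<Rightarrow> real) \<Rightarrow> ('a \<Rightarrow>\<^sub>L real) \<Rightarrow> real" where
  "conjugate \<theta> s = blinfun_apply s (mirror_map \<theta> s) - \<theta> (mirror_map \<theta> s)"

context
  fixes \<theta> :: "'a::finite_dim_normed_space \<Rightarrow> real" and \<theta>' :: "'a \<Rightarrow> 'a \<Rightarrow>\<^sub>L real"
  assumes proxy: "proxy_function \<theta> \<theta>'"
begin

private abbreviation (input) B :: "'a set" where "B \<equiv> cball 0 1"
private abbreviation (input) D :: "'a set" where "D \<equiv> subdiff_domain (cball 0 1) \<theta>"

lemma
  shows proxy_continuous: "continuous_on B \<theta>"
    and proxy_convex: "convex_on B \<theta>"
    and proxy_grad_continuous: "continuous_on D \<theta>'"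
    and proxy_grad_subgradient: "x \<in> D \<Longrightarrow> \<theta>' x \<in> subdifferential B \<theta> x"
    and proxy_grad_monotone: "x \<in> D \<Longrightarrow> x' \<in> D \<Longrightarrow>
          (norm (x - x'))\<^sup>2 \<le> blinfun_apply (\<theta>' x - \<theta>' x') (x - x')"
    and proxy_min: "x \<in> B \<Longrightarrow> \<theta> 0 \<le> \<theta> x"
  using proxy by (auto simp: proxy_function_def is_arg_min_linorder)

lemma mirror_map_exists: "\<exists>v. v \<in> B \<and> s \<in> subdifferential B \<theta> v"
proof -
  have "continuous_on B (\<lambda>v. blinfun_apply s v - \<theta> v)"
    by (intro continuous_intros proxy_continuous)
  then show ?thesis
    using continuous_attains_sup[OF compact_cball_finite_dim, of 1 "\<lambda>v. blinfun_apply s v - \<theta> v"]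
    by (auto simp: subdifferential_iff_maximizer)
qed

lemma
  shows mirror_map_in_cball: "norm (mirror_map \<theta> s) \<le> 1"
    and mirror_map_subgradient: "s \<in> subdifferential B \<theta> (mirror_map \<theta> s)"
  using someI_ex[OF mirror_map_exists[of s]] by (auto simp: mirror_map_def)

lemma fenchel_young: "v \<in> B \<Longrightarrow> blinfun_apply s v - \<theta> v \<le> conjugate \<theta> s"
  using mirror_map_subgradient[of s] by (auto simp: conjugate_def subdifferential_iff_maximizer)

lemma conjugate_subgradient:
  "conjugate \<theta> s + blinfun_apply h (mirror_map \<theta> s) \<le> conjugate \<theta> (s + h)"
  using fenchel_young[of "mirror_map \<theta> s" "s + h"] mirror_map_in_cball[of s]
  by (simp add: conjugate_def blinfun.add_left)

text \<open>
  If \<open>s\<close> is a subgradient at two points, then it is one on the whole segment between them, on which \<open>\<theta>\<close> is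
  affine with slope \<open>s\<close>. At inner points of the segment every subgradient, in particular the selected
  one, has the same slope along the segment. Two inner points then contradict the strong monotonicity of
  the selection.
\<close>

lemma subgradient_point_unique:
  assumes v: "v \<in> B" "s \<in> subdifferential B \<theta> v" and v': "v' \<in> B" "s \<in> subdifferential B \<theta> v'"
  shows "v = v'"
proof -
  define d where "d = v' - v"
  define w where "w r = v + r *\<^sub>R d" for r
  have w_eq: "w r = (1 - r) *\<^sub>R v + r *\<^sub>R v'" for r
    by (simp add: w_def d_def algebra_simps)
  have wB: "w r \<in> B" if "0 \<le> r" "r \<le> 1" for r
    unfolding w_eq using that v(1) v'(1) by (intro convexD[OF convex_cball]) auto
  have vv': "\<theta> v' = \<theta> v + blinfun_apply s d"
    using v v' by (force simp: subdifferential_def d_def blinfun.diff_right)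
  have w_val: "\<theta> (w r) = \<theta> v + r * blinfun_apply s d" if r: "0 \<le> r" "r \<le> 1" for r
  proof (rule antisym)
    have "\<theta> (w r) \<le> (1 - r) * \<theta> v + r * \<theta> v'"
      unfolding w_eq using r v v' proxy_convex by (intro convex_onD) auto
    then show "\<theta> (w r) \<le> \<theta> v + r * blinfun_apply s d"
      by (simp add: vv' algebra_simps)
    show "\<theta> v + r * blinfun_apply s d \<le> \<theta> (w r)"
      using bspec[OF v(2)[unfolded subdifferential_def, simplified] wB[OF r]]
      by (simp add: w_def blinfun.scaleR_right)
  qed
  have wD: "w r \<in> D" if r: "0 \<le> r" "r \<le> 1" for r
  proof -
    have "s \<in> subdifferential B \<theta> (w r)"
      using v(2) w_val[OF r]
      by (auto simp: subdifferential_def w_def blinfun.diff_right blinfun.add_right blinfun.scaleR_right)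
    then show ?thesis using wB[OF r] by (auto simp: subdiff_domain_def)
  qed
  have grad: "blinfun_apply (\<theta>' (w r)) d = blinfun_apply s d" if r: "0 < r" "r < 1" for r
  proof (rule antisym)
    have sub: "\<theta> (w r) + blinfun_apply (\<theta>' (w r)) (z - w r) \<le> \<theta> z" if "z \<in> B" for z
      using proxy_grad_subgradient[OF wD[of r]] r that by (auto simp: subdifferential_def)
    have vw: "v - w r = - (r *\<^sub>R d)" "v' - w r = (1 - r) *\<^sub>R d"
      by (simp_all add: w_def d_def algebra_simps)
    have 1: "r * blinfun_apply s d \<le> r * blinfun_apply (\<theta>' (w r)) d"
      using sub[OF v(1)] r unfolding vw by (simp add: w_val blinfun.scaleR_right blinfun.minus_right)
    have 2: "(1 - r) * blinfun_apply (\<theta>' (w r)) d \<le> (1 - r) * blinfun_apply s d"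
      using sub[OF v'(1)] r unfolding vw by (simp add: w_val vv' blinfun.scaleR_right left_diff_distrib)
    show "blinfun_apply s d \<le> blinfun_apply (\<theta>' (w r)) d"
      using mult_left_le_imp_le[OF 1] r by simp
    show "blinfun_apply (\<theta>' (w r)) d \<le> blinfun_apply s d"
      using mult_left_le_imp_le[OF 2] r by simp
  qed
  have diff: "w (1/3) - w (2/3) = - (1/3) *\<^sub>R d"
    by (simp add: w_def flip: scaleR_left_diff_distrib)
  have "(norm (w (1/3) - w (2/3)))\<^sup>2
      \<le> blinfun_apply (\<theta>' (w (1/3)) - \<theta>' (w (2/3))) (w (1/3) - w (2/3))"
    by (intro proxy_grad_monotone wD) auto
  also have "\<dots> = 0"
    using grad[of "1/3"] grad[of "2/3"] by (simp add: diff blinfun.bilinear_simps)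
  finally have "d = 0" by (simp add: diff)
  then show ?thesis by (simp add: d_def)
qed

lemma mirror_map_eqI: "v \<in> B \<Longrightarrow> s \<in> subdifferential B \<theta> v \<Longrightarrow> mirror_map \<theta> s = v"
  using subgradient_point_unique[of "mirror_map \<theta> s" s v] mirror_map_in_cball mirror_map_subgradient
  by auto

lemma conjugate_lipschitz: "\<bar>conjugate \<theta> s - conjugate \<theta> s'\<bar> \<le> norm (s - s')"
proof -
  have *: "conjugate \<theta> s - conjugate \<theta> s' \<le> norm (s - s')" for s s'
  proof -
    have "conjugate \<theta> s - conjugate \<theta> s' \<le> blinfun_apply (s - s') (mirror_map \<theta> s)"
      using conjugate_subgradient[of s "s' - s"] by (simp add: blinfun.diff_left)
    also have "\<dots> \<le> norm (s - s') * norm (mirror_map \<theta> s)"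
      using norm_blinfun[of "s - s'" "mirror_map \<theta> s"] by simp
    also have "\<dots> \<le> norm (s - s') * 1"
      by (intro mult_left_mono mirror_map_in_cball) auto
    finally show ?thesis by simp
  qed
  show ?thesis using *[of s s'] *[of s' s] by (simp add: norm_minus_commute)
qed

lemma conjugate_continuous: "continuous_on A (conjugate \<theta>)"
  using conjugate_lipschitz
  by (intro lipschitz_on_continuous_on[of 1] lipschitz_onI) (auto simp: dist_norm)

text \<open>
  The function \<open>J s = conjugate \<theta> s - \<langle>s, p\<rangle>\<close> grows linearly in \<open>\<parallel>s\<parallel>\<close> because \<open>p\<close> has positive distance from
  the sphere, so it has a minimiser \<open>s\<close>. The conjugate is differentiable, with gradient \<open>mirror_map \<theta>\<close>,
  since maximisers are unique. Stationarity of \<open>J\<close> therefore reads \<open>mirror_map \<theta> s = p\<close>, and \<open>s\<close> is a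
  subgradient at \<open>p\<close>.
\<close>

lemma ball_subset_subdiff_domain:
  assumes p: "norm p < 1"
  shows "p \<in> D"
proof -
  define J where "J s = conjugate \<theta> s - blinfun_apply s p" for s
  have "\<exists>v\<^sub>0\<in>B. \<forall>v\<in>B. \<theta> v \<le> \<theta> v\<^sub>0"
    using continuous_attains_sup[OF compact_cball_finite_dim, of 1 \<theta>] proxy_continuous
    by auto
  then obtain top where top: "\<And>v. v \<in> B \<Longrightarrow> \<theta> v \<le> top" by blast
  have coercive: "norm s \<le> (J s + top) / (1 - norm p)" for s
  proof (rule norm_blinfun_bound)
    have gen: "(1 - norm p) * blinfun_apply s u \<le> J s + top" if u: "norm u \<le> 1" for u
    proof -
      define v where "v = p + (1 - norm p) *\<^sub>R u"
      have "norm v \<le> norm p + norm ((1 - norm p) *\<^sub>R u)"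
        unfolding v_def by (rule norm_triangle_ineq)
      also have "norm ((1 - norm p) *\<^sub>R u) \<le> (1 - norm p) * 1"
        using u p by simp
      finally have "v \<in> B" by simp
      from fenchel_young[OF this, of s] top[OF this] show ?thesis
        by (simp add: J_def v_def blinfun.add_right blinfun.scaleR_right)
    qed
    from gen[of 0] show "0 \<le> (J s + top) / (1 - norm p)" using p by simp
    fix x
    show "norm (blinfun_apply s x) \<le> (J s + top) / (1 - norm p) * norm x"
    proof (cases "x = 0")
      case True
      then show ?thesis by simp
    next
      case False
      have "(1 - norm p) * blinfun_apply s x \<le> (J s + top) * norm x"
        "(1 - norm p) * (- blinfun_apply s x) \<le> (J s + top) * norm x"
        using gen[of "x /\<^sub>R norm x"] gen[of "- (x /\<^sub>R norm x)"] False
        by (simp_all add: blinfun.scaleR_right blinfun.minus_right field_simps)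
      then show ?thesis using p by (simp add: field_simps abs_le_iff)
    qed
  qed
  define \<rho> where "\<rho> = (J 0 + top) / (1 - norm p)"
  have "continuous_on (cball 0 \<rho>) J"
    unfolding J_def by (intro continuous_intros conjugate_continuous)
  moreover have "0 \<in> cball (0 :: 'a \<Rightarrow>\<^sub>L real) \<rho>" using coercive[of 0] by (simp add: \<rho>_def)
  ultimately have "\<exists>s\<in>cball 0 \<rho>. \<forall>s'\<in>cball 0 \<rho>. J s \<le> J s'"
    by (intro continuous_attains_inf compact_cball_finite_dim) auto
  then obtain s where s: "\<And>s'. s' \<in> cball 0 \<rho> \<Longrightarrow> J s \<le> J s'" by blast
  have min: "J s \<le> J s'" for s'
  proof (cases "s' \<in> cball 0 \<rho>")
    case False
    then have "\<rho> < norm s'" by simp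
    with coercive[of s'] have "\<rho> < (J s' + top) / (1 - norm p)" by linarith
    then have "J 0 < J s'" using p by (simp add: \<rho>_def divide_less_cancel)
    then show ?thesis using s[OF \<open>0 \<in> cball 0 \<rho>\<close>] by linarith
  qed (rule s)
  \<comment> \<open>One-sided derivative of \<open>J\<close> at its minimiser in direction \<open>k\<close>: the maximisers at the shifted
    functionals \<open>s + k / (n + 1)\<close> accumulate only at the maximiser for \<open>s\<close>.\<close>
  have nonneg: "0 \<le> blinfun_apply k (mirror_map \<theta> s - p)" for k :: "'a \<Rightarrow>\<^sub>L real"
  proof -
    define v where "v n = mirror_map \<theta> (s + (1 / real (Suc n)) *\<^sub>R k)" for n
    have vB: "v n \<in> B" for n using mirror_map_in_cball by (simp add: v_def)
    obtain c q where c: "c \<in> B" "strict_mono q" "(v \<circ> q) \<longlonglongrightarrow> c"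
      using compact_cball_finite_dim[of 1, unfolded compact_def, rule_format, of v] vB by blast
    have vc: "(\<lambda>n. v (q n)) \<longlonglongrightarrow> c" using c(3) by (simp add: o_def)
    have lim0: "(\<lambda>n. 1 / real (Suc (q n))) \<longlonglongrightarrow> 0"
      using LIMSEQ_subseq_LIMSEQ[OF LIMSEQ_inverse_real_of_nat c(2)] by (simp add: o_def inverse_eq_divide)
    have \<theta>c: "(\<lambda>n. \<theta> (v (q n))) \<longlonglongrightarrow> \<theta> c"
      using vc c(1) vB by (intro continuous_on_tendsto_compose[OF proxy_continuous vc]) auto
    have "s \<in> subdifferential B \<theta> c"
      unfolding subdifferential_iff_maximizer
    proof
      fix z :: 'a assume z: "z \<in> B"
      let ?s = "\<lambda>n. s + (1 / real (Suc (q n))) *\<^sub>R k"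
      have "(\<lambda>n. blinfun_apply (?s n) z - \<theta> z) \<longlonglongrightarrow> blinfun_apply (s + 0 *\<^sub>R k) z - \<theta> z"
        by (intro tendsto_intros lim0)
      moreover have "(\<lambda>n. blinfun_apply (?s n) (v (q n)) - \<theta> (v (q n)))
          \<longlonglongrightarrow> blinfun_apply (s + 0 *\<^sub>R k) c - \<theta> c"
        by (intro tendsto_intros lim0 \<theta>c vc)
      moreover have "blinfun_apply (?s n) z - \<theta> z \<le> blinfun_apply (?s n) (v (q n)) - \<theta> (v (q n))" for n
        using fenchel_young[OF z, of "?s n"] by (simp add: conjugate_def v_def)
      ultimately have "blinfun_apply (s + 0 *\<^sub>R k) z - \<theta> z \<le> blinfun_apply (s + 0 *\<^sub>R k) c - \<theta> c"
        by (intro LIMSEQ_le) auto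
      then show "blinfun_apply s z - \<theta> z \<le> blinfun_apply s c - \<theta> c" by simp
    qed
    then have "mirror_map \<theta> s = c" using c(1) by (rule mirror_map_eqI[rotated])
    moreover have "0 \<le> blinfun_apply k (v n - p)" for n
    proof -
      define h where "h = (1 / real (Suc n)) *\<^sub>R k"
      have "conjugate \<theta> s + blinfun_apply h p \<le> conjugate \<theta> (s + h)"
        using min[of "s + h"] by (simp add: J_def blinfun.add_left)
      moreover have "conjugate \<theta> (s + h) \<le> conjugate \<theta> s + blinfun_apply h (v n)"
        using conjugate_subgradient[of "s + h" "- h"] by (simp add: v_def h_def blinfun.minus_left)
      ultimately have "0 \<le> blinfun_apply h (v n - p)" by (simp add: blinfun.diff_right)
      then show ?thesis by (simp add: h_def blinfun.scaleR_left zero_le_divide_iff)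
    qed
    moreover have "(\<lambda>n. blinfun_apply k (v (q n) - p)) \<longlonglongrightarrow> blinfun_apply k (c - p)"
      by (intro tendsto_intros vc)
    ultimately show ?thesis by (intro LIMSEQ_le_const[of _ _ 0]) auto
  qed
  have "mirror_map \<theta> s - p = 0"
  proof (rule functionals_separate_points)
    show "blinfun_apply k (mirror_map \<theta> s - p) = 0" for k :: "'a \<Rightarrow>\<^sub>L real"
      using nonneg[of k] nonneg[of "- k"] by (simp add: blinfun.minus_left)
  qed
  then show ?thesis
    using mirror_map_subgradient[of s] mirror_map_in_cball[of s] by (auto simp: subdiff_domain_def)
qed

text \<open>
  If the growth bound holds with a constant \<open>c\<close>, applying it to both halves of the segment and using
  strong monotonicity at the midpoint gives it with \<open>c / 2 + 1 / 4\<close>. Starting from \<open>c = 0\<close>, which is the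
  subgradient inequality, the iteration converges to \<open>1 / 2\<close>.
\<close>

lemma proxy_growth_ball:
  assumes "norm x < 1" "norm y < 1"
  shows "\<theta> x + blinfun_apply (\<theta>' x) (y - x) + (norm (y - x))\<^sup>2 / 2 \<le> \<theta> y"
proof -
  have step: "\<theta> x + blinfun_apply (\<theta>' x) (y - x) + (1 - (1/2)^n) * ((norm (y - x))\<^sup>2 / 2) \<le> \<theta> y"
    if "norm x < 1" "norm y < 1" for x y n
    using that
  proof (induction n arbitrary: x y)
    case 0
    then show ?case
      using proxy_grad_subgradient[OF ball_subset_subdiff_domain[OF 0(1)]]
      by (simp add: subdifferential_def)
  next
    case (Suc n)
    define m where "m = (1/2) *\<^sub>R x + (1/2) *\<^sub>R y"
    have m: "norm m < 1"
      using convexD[OF convex_ball[of 0 1], of x y "1/2" "1/2"] Suc.prems by (simp add: m_def)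
    define d where "d = y - x"
    have mx: "m - x = (1/2) *\<^sub>R d" and ym: "y - m = (1/2) *\<^sub>R d"
      by (simp_all add: m_def d_def algebra_simps flip: scaleR_left_distrib)
    have "(norm (m - x))\<^sup>2 \<le> blinfun_apply (\<theta>' m - \<theta>' x) (m - x)"
      using Suc.prems m by (intro proxy_grad_monotone ball_subset_subdiff_domain)
    then have mono: "(norm d)\<^sup>2 \<le> 2 * blinfun_apply (\<theta>' m) d - 2 * blinfun_apply (\<theta>' x) d"
      by (simp add: mx blinfun.scaleR_right blinfun.diff_left power_divide)
    have "\<theta> x + blinfun_apply (\<theta>' x) d / 2 + (1 - (1/2)^n) * ((norm d)\<^sup>2 / 8) \<le> \<theta> m"
      "\<theta> m + blinfun_apply (\<theta>' m) d / 2 + (1 - (1/2)^n) * ((norm d)\<^sup>2 / 8) \<le> \<theta> y"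
      using Suc.IH[OF Suc.prems(1) m] Suc.IH[OF m Suc.prems(2)]
      by (simp_all add: mx ym blinfun.scaleR_right power_divide)
    moreover have "(1 - (1/2)^n) * ((norm d)\<^sup>2 / 8) = (norm d)\<^sup>2 / 8 - (1/2)^n * (norm d)\<^sup>2 / 8"
      "(1 - (1/2)^Suc n) * ((norm d)\<^sup>2 / 2) = (norm d)\<^sup>2 / 2 - (1/2)^n * (norm d)\<^sup>2 / 4"
      by (simp_all add: field_simps)
    ultimately show ?case
      using mono unfolding d_def[symmetric] by linarith
  qed
  have "(\<lambda>n. \<theta> x + blinfun_apply (\<theta>' x) (y - x) + (1 - (1/2)^n) * ((norm (y - x))\<^sup>2 / 2))
      \<longlonglongrightarrow> \<theta> x + blinfun_apply (\<theta>' x) (y - x) + (1 - 0) * ((norm (y - x))\<^sup>2 / 2)"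
    by (intro tendsto_intros LIMSEQ_power_zero) auto
  from LIMSEQ_le_const2[OF this] show ?thesis using step[OF assms] by auto
qed

text \<open>
  In the open ball the claim is a convex combination of two growth bounds at the intermediate point.
  Boundary points are limits of the shrunk points \<open>c n *\<^sub>R x\<close>.
\<close>

lemma proxy_strongly_convex:
  assumes x: "x \<in> B" and y: "y \<in> B" and r: "0 \<le> r" "r \<le> 1"
  shows "\<theta> ((1 - r) *\<^sub>R x + r *\<^sub>R y) + r * (1 - r) / 2 * (norm (y - x))\<^sup>2 \<le> (1 - r) * \<theta> x + r * \<theta> y"
proof -
  have inner: "\<theta> ((1 - r) *\<^sub>R x + r *\<^sub>R y) + r * (1 - r) / 2 * (norm (y - x))\<^sup>2
      \<le> (1 - r) * \<theta> x + r * \<theta> y" if "norm x < 1" "norm y < 1" for x y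
  proof -
    define w where "w = (1 - r) *\<^sub>R x + r *\<^sub>R y"
    have w: "norm w < 1"
      using convexD[OF convex_ball[of 0 1], of x y "1 - r" r] that r by (simp add: w_def)
    define d where "d = y - x"
    have xw: "x - w = - (r *\<^sub>R d)" and yw: "y - w = (1 - r) *\<^sub>R d"
      by (simp_all add: w_def d_def algebra_simps)
    have "(1 - r) * (\<theta> w + blinfun_apply (\<theta>' w) (x - w) + (norm (x - w))\<^sup>2 / 2)
        + r * (\<theta> w + blinfun_apply (\<theta>' w) (y - w) + (norm (y - w))\<^sup>2 / 2) \<le> (1 - r) * \<theta> x + r * \<theta> y"
      using r that w by (intro add_mono mult_left_mono proxy_growth_ball) auto
    then show ?thesis
      unfolding xw yw w_def[symmetric] d_def[symmetric] blinfun.scaleR_right blinfun.minus_right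
        norm_minus_cancel norm_scaleR
      using r by (simp add: power2_eq_square field_simps)
  qed
  define c where "c n = 1 - inverse (real (Suc n))" for n
  have c1: "c \<longlonglongrightarrow> 1"
    unfolding c_def using tendsto_diff[OF tendsto_const LIMSEQ_inverse_real_of_nat, of 1] by simp
  have c01: "0 \<le> c n" "c n < 1" for n by (auto simp: c_def field_simps)
  have cn: "norm (c n *\<^sub>R z) < 1" if "z \<in> B" for z n
  proof -
    have "c n * norm z \<le> c n * 1" using that c01[of n] by (intro mult_left_mono) auto
    then show ?thesis using c01[of n] by simp
  qed
  have lim: "(\<lambda>n. \<theta> (c n *\<^sub>R z)) \<longlonglongrightarrow> \<theta> (1 *\<^sub>R z)" if z: "z \<in> B" for z
    using cn[OF z] z less_imp_le
    by (intro continuous_on_tendsto_compose[OF proxy_continuous] tendsto_intros c1) (auto simp: less_imp_le)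
  have w: "(1 - r) *\<^sub>R x + r *\<^sub>R y \<in> B"
    using x y r by (intro convexD[OF convex_cball]) auto
  have "(\<lambda>n. \<theta> (c n *\<^sub>R ((1 - r) *\<^sub>R x + r *\<^sub>R y)) + r * (1 - r) / 2 * (norm (c n *\<^sub>R y - c n *\<^sub>R x))\<^sup>2)
      \<longlonglongrightarrow> \<theta> (1 *\<^sub>R ((1 - r) *\<^sub>R x + r *\<^sub>R y)) + r * (1 - r) / 2 * (norm (1 *\<^sub>R y - 1 *\<^sub>R x))\<^sup>2"
    by (intro tendsto_intros lim w c1)
  moreover have "(\<lambda>n. (1 - r) * \<theta> (c n *\<^sub>R x) + r * \<theta> (c n *\<^sub>R y))
      \<longlonglongrightarrow> (1 - r) * \<theta> (1 *\<^sub>R x) + r * \<theta> (1 *\<^sub>R y)"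
    by (intro tendsto_intros lim x y)
  moreover have "\<theta> (c n *\<^sub>R ((1 - r) *\<^sub>R x + r *\<^sub>R y)) + r * (1 - r) / 2 * (norm (c n *\<^sub>R y - c n *\<^sub>R x))\<^sup>2
      \<le> (1 - r) * \<theta> (c n *\<^sub>R x) + r * \<theta> (c n *\<^sub>R y)" for n
    using inner[OF cn[OF x] cn[OF y], of n n] by (simp add: scaleR_right_distrib mult.commute)
  ultimately have "\<theta> (1 *\<^sub>R ((1 - r) *\<^sub>R x + r *\<^sub>R y)) + r * (1 - r) / 2 * (norm (1 *\<^sub>R y - 1 *\<^sub>R x))\<^sup>2
      \<le> (1 - r) * \<theta> (1 *\<^sub>R x) + r * \<theta> (1 *\<^sub>R y)"
    by (intro LIMSEQ_le) auto
  then show ?thesis by simp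
qed

text \<open>
  Strong convexity compares \<open>\<theta>\<close> at a point close to \<open>x\<close> on the segment to \<open>y\<close> with the end points, the
  subgradient inequality bounds it from below there; divide by the distance to \<open>x\<close> and let it vanish. The
  arbitrary subgradient \<open>s\<close> matters because \<open>mirror_map \<theta> s\<close> has \<open>s\<close> as a subgradient, but not
  necessarily as the selected one.
\<close>

lemma proxy_growth:
  assumes x: "x \<in> B" "s \<in> subdifferential B \<theta> x" and y: "y \<in> B"
  shows "\<theta> x + blinfun_apply s (y - x) + (norm (y - x))\<^sup>2 / 2 \<le> \<theta> y"
proof -
  have "c * ((norm (y - x))\<^sup>2 / 2) \<le> \<theta> y - \<theta> x - blinfun_apply s (y - x)" if c: "0 < c" "c < 1" for c
  proof -
    define r where "r = 1 - c"
    have r: "0 < r" "r < 1" using c by (auto simp: r_def)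
    define w where "w = (1 - r) *\<^sub>R x + r *\<^sub>R y"
    define d where "d = y - x"
    have "w \<in> B" unfolding w_def using x y r by (intro convexD[OF convex_cball]) auto
    then have "\<theta> x + blinfun_apply s (w - x) \<le> \<theta> w" using x(2) by (auto simp: subdifferential_def)
    moreover have "w - x = r *\<^sub>R d" by (simp add: w_def d_def algebra_simps)
    ultimately have "\<theta> x + r * blinfun_apply s d \<le> \<theta> w" by (simp add: blinfun.scaleR_right)
    moreover have "\<theta> w + r * (1 - r) / 2 * (norm (y - x))\<^sup>2 \<le> (1 - r) * \<theta> x + r * \<theta> y"
      unfolding w_def using proxy_strongly_convex[OF x(1) y, of r] r by simp
    ultimately have "r * (c * ((norm d)\<^sup>2 / 2)) \<le> r * (\<theta> y - \<theta> x - blinfun_apply s d)"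
      unfolding d_def[symmetric] by (simp add: r_def algebra_simps)
    then show ?thesis using r(1) unfolding d_def by (rule mult_left_le_imp_le)
  qed
  from field_le_mult_one_interval[OF this] show ?thesis by linarith
qed

lemma mirror_map_lipschitz: "norm (mirror_map \<theta> s - mirror_map \<theta> s') \<le> norm (s - s')"
proof -
  define d where "d = mirror_map \<theta> s' - mirror_map \<theta> s"
  have "\<theta> (mirror_map \<theta> s) + blinfun_apply s d + (norm d)\<^sup>2 / 2 \<le> \<theta> (mirror_map \<theta> s')"
    unfolding d_def using mirror_map_in_cball mirror_map_subgradient by (intro proxy_growth) auto
  moreover have "\<theta> (mirror_map \<theta> s') + blinfun_apply s' (- d) + (norm (- d))\<^sup>2 / 2 \<le> \<theta> (mirror_map \<theta> s)"
    unfolding d_def minus_diff_eq using mirror_map_in_cball mirror_map_subgradient by (intro proxy_growth) auto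
  ultimately have "(norm d)\<^sup>2 \<le> blinfun_apply (s' - s) d"
    by (simp add: blinfun.minus_right blinfun.diff_left)
  also have "\<dots> \<le> norm (s' - s) * norm d"
    using norm_blinfun[of "s' - s" d] by simp
  finally have "norm d * norm d \<le> norm (s' - s) * norm d" by (simp add: power2_eq_square)
  then have "norm d \<le> norm (s' - s)"
    by (cases "norm d = 0") (auto dest: mult_right_le_imp_le)
  then show ?thesis by (simp add: d_def norm_minus_commute)
qed

lemma mirror_map_continuous: "continuous_on A (mirror_map \<theta>)"
  using mirror_map_lipschitz
  by (intro lipschitz_on_continuous_on[of 1] lipschitz_onI) (auto simp: dist_norm)

text \<open>
  Duality between strong convexity of \<open>\<theta>\<close> and smoothness of its conjugate.
\<close>

lemma conjugate_smooth:
  "conjugate \<theta> (s + h) \<le> conjugate \<theta> s + blinfun_apply h (mirror_map \<theta> s) + (norm h)\<^sup>2 / 2"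
proof -
  define v v' where "v = mirror_map \<theta> s" and "v' = mirror_map \<theta> (s + h)"
  have "\<theta> v + blinfun_apply s (v' - v) + (norm (v' - v))\<^sup>2 / 2 \<le> \<theta> v'"
    unfolding v_def v'_def using mirror_map_in_cball mirror_map_subgradient by (intro proxy_growth) auto
  moreover have "blinfun_apply h (v' - v) \<le> norm h * norm (v' - v)"
    using norm_blinfun[of h "v' - v"] by simp
  moreover have "norm h * norm (v' - v) \<le> (norm h)\<^sup>2 / 2 + (norm (v' - v))\<^sup>2 / 2"
    using sum_squares_bound[of "norm h" "norm (v' - v)"] by simp
  ultimately show ?thesis
    unfolding conjugate_def v_def[symmetric] v'_def[symmetric]
    by (simp add: blinfun.diff_right blinfun.add_left)
qed

lemma proxy_range_upper:
  assumes "v \<in> B"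
  shows "\<theta> v - \<theta> 0 \<le> proxy_range \<theta>"
proof -
  have "compact (\<theta> ` B)"
    by (intro compact_continuous_image proxy_continuous compact_cball_finite_dim)
  then have "bdd_above (\<theta> ` B)" "bdd_below (\<theta> ` B)"
    by (simp_all add: bounded_imp_bdd_above bounded_imp_bdd_below compact_imp_bounded)
  then have "\<theta> v \<le> (SUP x\<in>B. \<theta> x)" "(INF x\<in>B. \<theta> x) \<le> \<theta> 0"
    using assms by (auto intro!: cSUP_upper cINF_lower)
  then show ?thesis by (simp add: proxy_range_def)
qed

lemma proxy_range_nonneg: "0 \<le> proxy_range \<theta>"
  using proxy_range_upper[of 0] by simp

text \<open>
  In the trivial space the range is 0, so a nonzero vector has to be assumed.
\<close>

lemma proxy_range_pos:
  assumes "(x :: 'a) \<noteq> 0"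
  shows "0 < proxy_range \<theta>"
proof -
  have "0 \<in> subdifferential B \<theta> 0" using proxy_min by (simp add: subdifferential_def)
  then have "\<theta> 0 + (norm (x /\<^sub>R norm x))\<^sup>2 / 2 \<le> \<theta> (x /\<^sub>R norm x)"
    using proxy_growth[of 0 0 "x /\<^sub>R norm x"] assms by simp
  then show ?thesis using proxy_range_upper[of "x /\<^sub>R norm x"] assms by simp
qed

text \<open>
  The potential \<open>conjugate \<theta> (\<eta> *\<^sub>R (\<xi>\<^sub>1 + \<dots> + \<xi>\<^sub>i))\<close> starts below \<open>- \<theta> 0\<close>, increases by at most the
  linear gain of the current iterate plus a quadratic term, and dominates the gain of every fixed \<open>v\<close>
  minus \<open>\<theta> v\<close>.
\<close>

lemma dual_averaging_regret:
  fixes \<xi> :: "nat \<Rightarrow> 'a \<Rightarrow>\<^sub>L real"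
  assumes \<eta>: "\<eta> > 0" and v: "v \<in> B"
  shows "(\<Sum>i=1..n. blinfun_apply (\<xi> i) (v - mirror_map \<theta> (\<eta> *\<^sub>R (\<Sum>j=1..i-1. \<xi> j))))
    \<le> proxy_range \<theta> / \<eta> + \<eta> / 2 * (\<Sum>i=1..n. (norm (\<xi> i))\<^sup>2)"
proof -
  define S where "S i = (\<Sum>j=1..i. \<xi> j)" for i
  have bound: "conjugate \<theta> (\<eta> *\<^sub>R S n)
      \<le> - \<theta> 0 + (\<Sum>i=1..n. \<eta> * blinfun_apply (\<xi> i) (mirror_map \<theta> (\<eta> *\<^sub>R S (i - 1))) + \<eta>\<^sup>2 * (norm (\<xi> i))\<^sup>2 / 2)"
  proof (induction n)
    case 0
    then show ?case using mirror_map_in_cball proxy_min by (simp add: S_def conjugate_def)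
  next
    case (Suc n)
    have "\<eta> *\<^sub>R S (Suc n) = \<eta> *\<^sub>R S n + \<eta> *\<^sub>R \<xi> (Suc n)"
      by (simp add: S_def scaleR_right_distrib)
    then show ?case
      using conjugate_smooth[of "\<eta> *\<^sub>R S n" "\<eta> *\<^sub>R \<xi> (Suc n)"] Suc
      by (simp add: blinfun.scaleR_left power_mult_distrib)
  qed
  have "\<eta> * (\<Sum>i=1..n. blinfun_apply (\<xi> i) (v - mirror_map \<theta> (\<eta> *\<^sub>R S (i - 1))))
      = blinfun_apply (\<eta> *\<^sub>R S n) v - (\<Sum>i=1..n. \<eta> * blinfun_apply (\<xi> i) (mirror_map \<theta> (\<eta> *\<^sub>R S (i - 1))))"
    by (simp add: S_def blinfun.diff_right blinfun.scaleR_left blinfun.sum_left sum_subtractf sum_distrib_left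
        algebra_simps)
  also have "\<dots> \<le> \<theta> v - \<theta> 0 + (\<Sum>i=1..n. \<eta>\<^sup>2 * (norm (\<xi> i))\<^sup>2 / 2)"
    using fenchel_young[OF v, of "\<eta> *\<^sub>R S n"] bound by (simp add: sum.distrib)
  also have "\<dots> \<le> \<eta> * (proxy_range \<theta> / \<eta> + \<eta> / 2 * (\<Sum>i=1..n. (norm (\<xi> i))\<^sup>2))"
    using proxy_range_upper[OF v] \<eta> by (simp add: sum_distrib_left algebra_simps power2_eq_square)
  finally show ?thesis
    using \<eta> by (simp add: S_def)
qed

end

section \<open>Exponential moments of truncated noise\<close>

lemma exp_2_le: "exp 2 \<le> (37/5 :: real)"
proof -
  have "exp 2 = (exp 1 :: real)\<^sup>2"
    by (simp add: power2_eq_square flip: exp_add)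
  also have "\<dots> \<le> (272/100)\<^sup>2"
    using e_less_272 by (intro power_mono) auto
  also have "\<dots> \<le> 37/5" by (simp add: power2_eq_square)
  finally show ?thesis .
qed

text \<open>
  The chord of the exponential over \<open>[0, 2]\<close>. The exponents that occur below are scaled so that they do not
  exceed 2 in absolute value.
\<close>

lemma exp_le_linear:
  assumes "0 \<le> u" "u \<le> (2::real)"
  shows "exp u \<le> 1 + 16/5 * u"
proof -
  have "exp ((1 - u/2) *\<^sub>R 0 + (u/2) *\<^sub>R 2) \<le> (1 - u/2) * exp 0 + (u/2) * exp (2::real)"
    using assms by (intro convex_onD[OF exp_convex]) auto
  also have "\<dots> \<le> (1 - u/2) * 1 + (u/2) * (37/5)"
    using assms exp_2_le by (intro add_mono mult_left_mono) auto
  finally show ?thesis by simp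
qed

text \<open>
  Bernstein's argument: on \<open>[-2, 2]\<close> the quotient \<open>(exp u - 1 - u) / u\<^sup>2\<close> is largest at \<open>u = 2\<close>, as one sees
  by comparing the power series term by term.
\<close>

lemma exp_le_quadratic:
  assumes u: "\<bar>u\<bar> \<le> (2::real)"
  shows "exp u \<le> 1 + u + 11/10 * u\<^sup>2"
proof -
  define a where "a n = inverse (fact (n + 2) :: real)" for n
  have summable: "summable (\<lambda>n. a n * x ^ (n + 2))" for x :: real
    using summable_ignore_initial_segment[OF summable_exp[of x], of 2] by (simp add: a_def)
  have tail: "exp x = 1 + x + (\<Sum>n. a n * x ^ (n + 2))" for x :: real
    by (subst exp_first_two_terms) (simp add: a_def)
  have "(\<Sum>n. a n * u ^ (n + 2)) \<le> (\<Sum>n. u\<^sup>2 / 4 * (a n * 2 ^ (n + 2)))"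
  proof (intro suminf_le summable summable_mult)
    fix n
    have "u ^ n \<le> 2 ^ n"
      using power_mono[OF u, of n] abs_ge_self[of "u ^ n"] by (simp add: power_abs)
    then have "a n * u\<^sup>2 * u ^ n \<le> a n * u\<^sup>2 * 2 ^ n"
      by (intro mult_left_mono) (auto simp: a_def)
    then show "a n * u ^ (n + 2) \<le> u\<^sup>2 / 4 * (a n * 2 ^ (n + 2))"
      by (simp add: power_add power2_eq_square mult_ac)
  qed
  also have "\<dots> = u\<^sup>2 / 4 * (exp 2 - 3)"
    using tail[of 2] by (subst suminf_mult[OF summable]) simp
  also have "\<dots> \<le> u\<^sup>2 / 4 * (22/5)"
    using exp_2_le by (intro mult_left_mono) auto
  finally show ?thesis using tail[of u] by simp
qed

lemma (in prob_space) nn_exp_moment_square: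
  assumes B: "B > 0" and Z: "integrable M Z" "expectation Z \<le> v"
    and f: "\<And>w. w \<in> space M \<Longrightarrow> 0 \<le> f w" "\<And>w. w \<in> space M \<Longrightarrow> f w \<le> B\<^sup>2"
      "\<And>w. w \<in> space M \<Longrightarrow> f w \<le> c * Z w"
    and c: "c \<ge> 0"
  shows "(\<integral>\<^sup>+w. ennreal (exp (2 / B\<^sup>2 * f w)) \<partial>M) \<le> ennreal (exp (32/5 * c * v / B\<^sup>2))"
proof -
  define h where "h w = 1 + 32/5 * c / B\<^sup>2 * Z w" for w
  have pw: "exp (2 / B\<^sup>2 * f w) \<le> h w" if "w \<in> space M" for w
  proof -
    have "exp (2 / B\<^sup>2 * f w) \<le> 1 + 16/5 * (2 / B\<^sup>2 * f w)"
      using f(1,2)[OF that] B by (intro exp_le_linear) (auto simp: field_simps)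
    also have "\<dots> \<le> h w"
      using f(3)[OF that] B by (simp add: h_def divide_right_mono)
    finally show ?thesis .
  qed
  have h_int: "integrable M h" unfolding h_def using Z(1) by simp
  have "(\<integral>\<^sup>+w. ennreal (exp (2 / B\<^sup>2 * f w)) \<partial>M) \<le> (\<integral>\<^sup>+w. ennreal (h w) \<partial>M)"
    using pw by (intro nn_integral_mono ennreal_leI)
  also have "\<dots> = ennreal (expectation h)"
    using pw by (intro nn_integral_eq_integral h_int AE_I2) (meson exp_ge_zero order_trans)
  also have "expectation h = 1 + 32/5 * c / B\<^sup>2 * expectation Z"
    unfolding h_def using Z by (simp add: prob_space)
  also have "\<dots> \<le> 1 + 32/5 * c / B\<^sup>2 * v"
    using Z(2) c by (intro add_left_mono mult_left_mono) auto
  also have "\<dots> \<le> exp (32/5 * c * v / B\<^sup>2)"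
    using exp_ge_add_one_self[of "32/5 * c * v / B\<^sup>2"] by simp
  finally show ?thesis by (simp add: ennreal_leI)
qed

text \<open>
  Bernstein's moment bound for a variable that is not centred: \<open>T\<close> is the centred part, and the bias is
  absorbed by the same variable \<open>Z\<close> that controls the second moment.
\<close>

lemma (in prob_space) nn_exp_moment_biased:
  assumes B: "B > 0" and Z: "integrable M Z" "expectation Z \<le> v"
    and T: "integrable M T" "expectation T = 0"
    and f: "\<And>w. w \<in> space M \<Longrightarrow> \<bar>f w\<bar> \<le> B"
      "\<And>w. w \<in> space M \<Longrightarrow> (f w)\<^sup>2 \<le> c * Z w"
      "\<And>w. w \<in> space M \<Longrightarrow> f w \<le> T w + e * Z w"
    and c: "c \<ge> 0" "e \<ge> 0"
  shows "(\<integral>\<^sup>+w. ennreal (exp (2 / B * f w)) \<partial>M) \<le> ennreal (exp (2 * e * v / B + 22/5 * c * v / B\<^sup>2))"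
proof -
  define h where "h w = 1 + (2 / B * T w + (2 * e / B + 22/5 * c / B\<^sup>2) * Z w)" for w
  have pw: "exp (2 / B * f w) \<le> h w" if w: "w \<in> space M" for w
  proof -
    have "exp (2 / B * f w) \<le> 1 + 2 / B * f w + 11/10 * (2 / B * f w)\<^sup>2"
      using f(1)[OF w] B by (intro exp_le_quadratic) (auto simp: abs_mult field_simps)
    also have "(2 / B * f w)\<^sup>2 = 4 / B\<^sup>2 * (f w)\<^sup>2"
      by (simp add: power_mult_distrib power_divide)
    also have "1 + 2 / B * f w + 11/10 * (4 / B\<^sup>2 * (f w)\<^sup>2)
        \<le> 1 + 2 / B * (T w + e * Z w) + 11/10 * (4 / B\<^sup>2 * (c * Z w))"
      using f(2,3)[OF w] B by (intro add_mono mult_left_mono) auto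
    also have "\<dots> = h w"
      by (simp add: h_def algebra_simps)
    finally show ?thesis .
  qed
  have h_int: "integrable M h"
    unfolding h_def using Z(1) T(1) by simp
  have "(\<integral>\<^sup>+w. ennreal (exp (2 / B * f w)) \<partial>M) \<le> (\<integral>\<^sup>+w. ennreal (h w) \<partial>M)"
    using pw by (intro nn_integral_mono ennreal_leI)
  also have "\<dots> = ennreal (expectation h)"
    using pw by (intro nn_integral_eq_integral h_int AE_I2) (meson exp_ge_zero order_trans)
  also have "expectation h = 1 + (2 * e / B + 22/5 * c / B\<^sup>2) * expectation Z"
    unfolding h_def using Z T by (simp add: prob_space)
  also have "\<dots> \<le> 1 + (2 * e / B + 22/5 * c / B\<^sup>2) * v"
    using Z(2) c B by (intro add_left_mono mult_left_mono) auto
  also have "\<dots> \<le> exp (2 * e * v / B + 22/5 * c * v / B\<^sup>2)"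
    using exp_ge_add_one_self[of "2 * e * v / B + 22/5 * c * v / B\<^sup>2"] by (simp add: algebra_simps)
  finally show ?thesis by (simp add: ennreal_leI)
qed

text \<open>
  Here \<open>u\<close> is an observation with mean \<open>m\<close>, replaced by the rough estimate \<open>c\<close> of \<open>m\<close> when it is far from
  \<open>c\<close>. Replacement forces \<open>lev < norm (u - m)\<close>, so that the error made by it can be multiplied by any power of
  \<open>norm (u - m) / lev\<close>.
\<close>

lemma
  fixes u c m :: "'b::real_normed_vector"
  assumes a: "norm (c - m) \<le> a" and lev: "lev > 0" "lev \<le> a'" "a \<le> a'"
  defines "\<xi> \<equiv> (if norm (u - c) \<le> a + lev then u else c) - m"
  shows truncation_bound: "norm \<xi> \<le> 2 * a' + lev"
    and truncation_domination: "norm \<xi> \<le> a' / lev * norm (u - m)"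
    and truncation_bias: "norm (\<xi> - (u - m)) \<le> (a' / lev\<^sup>2 + 1 / lev) * (norm (u - m))\<^sup>2"
proof -
  have a_ge: "0 \<le> a" using a norm_ge_zero order_trans by blast
  have tri: "norm (u - m) \<le> norm (u - c) + norm (c - m)" "norm (u - c) \<le> norm (u - m) + norm (c - m)"
    using norm_triangle_ineq[of "u - c" "c - m"] norm_triangle_ineq4[of "u - m" "c - m"] by simp_all
  have ratio: "1 \<le> a' / lev" using lev by simp
  have noise: "lev \<le> norm (u - m)" if "\<not> norm (u - c) \<le> a + lev"
    using that tri(2) a by linarith
  show "norm \<xi> \<le> 2 * a' + lev"
    using tri(1) a a_ge lev by (auto simp: \<xi>_def)
  show "norm \<xi> \<le> a' / lev * norm (u - m)"
  proof (cases "norm (u - c) \<le> a + lev")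
    case True
    then show ?thesis
      using mult_right_mono[OF ratio, of "norm (u - m)"] by (simp add: \<xi>_def)
  next
    case False
    have "norm \<xi> \<le> a' / lev * lev" using False a lev by (simp add: \<xi>_def)
    also have "\<dots> \<le> a' / lev * norm (u - m)"
      using noise[OF False] lev by (intro mult_left_mono) auto
    finally show ?thesis .
  qed
  show "norm (\<xi> - (u - m)) \<le> (a' / lev\<^sup>2 + 1 / lev) * (norm (u - m))\<^sup>2"
  proof (cases "norm (u - c) \<le> a + lev")
    case True
    then show ?thesis using lev by (simp add: \<xi>_def)
  next
    case False
    let ?z = "norm (u - m)"
    have z: "lev \<le> ?z" by (rule noise[OF False])
    have "norm (\<xi> - (u - m)) = norm (u - c)" using False by (simp add: \<xi>_def norm_minus_commute)
    also have "\<dots> \<le> a' + ?z" using tri(2) a lev by linarith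
    finally have "norm (\<xi> - (u - m)) \<le> a' + ?z" .
    moreover have "a' \<le> a' / lev\<^sup>2 * ?z\<^sup>2"
    proof -
      have "lev\<^sup>2 \<le> ?z\<^sup>2" using z lev by (intro power_mono) auto
      then have "a' * lev\<^sup>2 \<le> a' * ?z\<^sup>2" using lev by (intro mult_left_mono) auto
      then show ?thesis using lev by (simp add: field_simps)
    qed
    moreover have "?z \<le> 1 / lev * ?z\<^sup>2"
    proof -
      have "lev * ?z \<le> ?z * ?z" using z by (intro mult_right_mono) auto
      then show ?thesis using lev by (simp add: field_simps power2_eq_square)
    qed
    ultimately show ?thesis by (simp add: distrib_right)
  qed
qed

text \<open>
  This and the next lemma are where the constants 40 and 8, hence those of \<open>rho_bar\<close>, come from: the
  left-hand sides are the tail bounds obtained from the two moment bounds, with \<open>5 * l + 3 * k\<close> for \<open>B\<close>.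
  By homogeneity they are inequalities in the ratio \<open>p = k / l\<close> in \<open>[0, 1]\<close>.
\<close>

lemma truncation_constant_square:
  assumes l: "l > 0" "0 \<le> k" "k \<le> (l::real)"
  shows "(5 * l + 3 * k)\<^sup>2 / 2 + 16/5 * ((2 * l + k) / (l + k))\<^sup>2 * l\<^sup>2 \<le> 40 * l\<^sup>2"
proof -
  define p where "p = k / l"
  have p: "0 \<le> p" "p \<le> 1" and k: "k = p * l" using l by (auto simp: p_def)
  have eqs: "(2 * l + k) / (l + k) = (2 + p) / (1 + p)" "5 * l + 3 * k = (5 + 3 * p) * l"
  proof -
    have "2 * l + k = l * (2 + p)" "l + k = l * (1 + p)" by (simp_all add: k algebra_simps)
    then show "(2 * l + k) / (l + k) = (2 + p) / (1 + p)" using l by simp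
  qed (simp add: k algebra_simps)
  have "(5 + 3 * p)\<^sup>2 / 2 + 16/5 * ((2 + p) / (1 + p))\<^sup>2 \<le> 40"
  proof -
    have "p\<^sup>2 \<le> p" "p^3 \<le> p" "p^4 \<le> p" using p power_decreasing[of 1 _ p] by simp_all
    moreover have "80 * (1 + p)\<^sup>2 - ((5 + 3 * p)\<^sup>2 * (1 + p)\<^sup>2 + 32/5 * (2 + p)\<^sup>2)
        = 147/5 + 272/5 * p - 102/5 * p\<^sup>2 - 48 * p^3 - 9 * p^4"
      by (simp add: power2_eq_square power3_eq_cube power4_eq_xxxx field_simps)
    ultimately have "(5 + 3 * p)\<^sup>2 * (1 + p)\<^sup>2 + 32/5 * (2 + p)\<^sup>2 \<le> 80 * (1 + p)\<^sup>2"
      using p by linarith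
    then show ?thesis using p by (simp add: power_divide field_simps)
  qed
  then have "((5 + 3 * p)\<^sup>2 / 2 + 16/5 * ((2 + p) / (1 + p))\<^sup>2) * l\<^sup>2 \<le> 40 * l\<^sup>2"
    by (rule mult_right_mono) simp
  then show ?thesis unfolding eqs power_mult_distrib by (simp add: distrib_right)
qed

lemma truncation_constant_linear:
  assumes l: "l > 0" "0 \<le> k" "k \<le> (l::real)"
  shows "(5 * l + 3 * k) / 2 + ((2 * l + k) / (l + k)\<^sup>2 + 1 / (l + k)) * l\<^sup>2
    + 11/5 * ((2 * l + k) / (l + k))\<^sup>2 * l\<^sup>2 / (5 * l + 3 * k) \<le> 8 * l"
proof -
  define p where "p = k / l"
  have p: "0 \<le> p" "p \<le> 1" and k: "k = p * l" using l by (auto simp: p_def)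
  have eqs: "2 * l + k = l * (2 + p)" "l + k = l * (1 + p)" "5 * l + 3 * k = l * (5 + 3 * p)"
    by (simp_all add: k algebra_simps)
  have main: "(5 + 3 * p) / 2 + ((2 + p) / (1 + p)\<^sup>2 + 1 / (1 + p)) + 11/5 * ((2 + p) / (1 + p))\<^sup>2 / (5 + 3 * p) \<le> 8"
  proof -
    have "p^3 \<le> p" using p power_decreasing[of 1 3 p] by simp
    then have "2 * (3 + 2 * p) \<le> (6 - 3 * p) * (1 + p)\<^sup>2"
      using p by (simp add: power2_eq_square power3_eq_cube algebra_simps)
    then have "3 + 2 * p \<le> (6 - 3 * p) / 2 * (1 + p)\<^sup>2" by simp
    then have "(3 + 2 * p) / (1 + p)\<^sup>2 \<le> (6 - 3 * p) / 2"
      using p by (simp add: divide_le_eq)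
    moreover have "(2 + p) / (1 + p)\<^sup>2 + 1 / (1 + p) = (3 + 2 * p) / (1 + p)\<^sup>2"
      using p by (simp add: power2_eq_square divide_simps)
    moreover have "(5 + 3 * p) / 2 + (6 - 3 * p) / 2 = 11/2" by (simp add: field_simps)
    ultimately have 1: "(5 + 3 * p) / 2 + ((2 + p) / (1 + p)\<^sup>2 + 1 / (1 + p)) \<le> 11/2"
      by linarith
    have "((2 + p) / (1 + p))\<^sup>2 \<le> 2\<^sup>2"
      using p by (intro power_mono) (auto simp: field_simps)
    then have "11/5 * ((2 + p) / (1 + p))\<^sup>2 / (5 + 3 * p) \<le> 11/5 * 2\<^sup>2 / 5"
      using p by (intro frac_le mult_left_mono) auto
    moreover have "11/5 * 2\<^sup>2 / 5 \<le> (5/2 :: real)" by simp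
    ultimately show ?thesis using 1 by linarith
  qed
  have "((2 * l + k) / (l + k)\<^sup>2 + 1 / (l + k)) * l\<^sup>2 = l * ((2 + p) / (1 + p)\<^sup>2 + 1 / (1 + p))"
  proof -
    have "(2 * l + k) / (l + k)\<^sup>2 * l\<^sup>2 = l * ((2 + p) / (1 + p)\<^sup>2)" "1 / (l + k) * l\<^sup>2 = l * (1 / (1 + p))"
      unfolding eqs using l by (simp_all add: power_mult_distrib power2_eq_square)
    then show ?thesis by (simp only: distrib_left distrib_right)
  qed
  moreover have "11/5 * ((2 * l + k) / (l + k))\<^sup>2 * l\<^sup>2 / (5 * l + 3 * k)
      = l * (11/5 * ((2 + p) / (1 + p))\<^sup>2 / (5 + 3 * p))"
  proof -
    have "(2 * l + k) / (l + k) = (2 + p) / (1 + p)" unfolding eqs using l by simp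
    then show ?thesis unfolding eqs(3) using l by (simp add: power2_eq_square mult_ac)
  qed
  moreover have "(5 * l + 3 * k) / 2 = l * ((5 + 3 * p) / 2)" unfolding eqs by simp
  moreover have "l * ((5 + 3 * p) / 2 + ((2 + p) / (1 + p)\<^sup>2 + 1 / (1 + p)) + 11/5 * ((2 + p) / (1 + p))\<^sup>2 / (5 + 3 * p)) \<le> l * 8"
    using main l by (intro mult_left_mono) auto
  ultimately show ?thesis by (simp only: distrib_left mult.commute)
qed

text \<open>
  The two conditional moment bounds for one step: for the squared norm of the noise, and for its value in
  a direction \<open>d\<close> that is fixed given the past. In both, the comparison with the original noise makes its
  variance \<open>v\<close> appear instead of the square of the bound \<open>B\<close>.
\<close>

lemma (in prob_space) truncated_noise_moments:
  fixes u :: "'a \<Rightarrow> 'b::finite_dim_normed_space \<Rightarrow>\<^sub>L real"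
  assumes u: "integrable M u" "expectation u = m"
    and var: "integrable M (\<lambda>w. (norm (u w - m))\<^sup>2)" "expectation (\<lambda>w. (norm (u w - m))\<^sup>2) \<le> v"
    and c: "norm (c - m) \<le> a" "a \<le> 2 * l + k" and l: "l > 0" "0 \<le> k"
  defines "\<xi> \<equiv> \<lambda>w. (if norm (u w - c) \<le> a + (l + k) then u w else c) - m"
    and "B \<equiv> 5 * l + 3 * k" and "r \<equiv> (2 * l + k) / (l + k)"
    and "e \<equiv> (2 * l + k) / (l + k)\<^sup>2 + 1 / (l + k)"
  shows "(\<integral>\<^sup>+w. ennreal (exp (2 / B\<^sup>2 * (norm (\<xi> w))\<^sup>2)) \<partial>M) \<le> ennreal (exp (32/5 * r\<^sup>2 * v / B\<^sup>2))"
    and "norm d \<le> 1 \<Longrightarrow> (\<integral>\<^sup>+w. ennreal (exp (2 / B * blinfun_apply (\<xi> w) d)) \<partial>M)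
      \<le> ennreal (exp (2 * e * v / B + 22/5 * r\<^sup>2 * v / B\<^sup>2))"
proof -
  let ?Z = "\<lambda>w. (norm (u w - m))\<^sup>2"
  have B: "B > 0" and e: "e \<ge> 0" using l by (auto simp: B_def e_def)
  have lev: "0 < l + k" "l + k \<le> 2 * l + k" using l by auto
  have bound: "norm (\<xi> w) \<le> B" for w
    using truncation_bound[OF c(1) lev c(2), of "u w"] by (simp add: \<xi>_def B_def)
  have dom: "(norm (\<xi> w))\<^sup>2 \<le> r\<^sup>2 * ?Z w" for w
  proof -
    have "norm (\<xi> w) \<le> r * norm (u w - m)"
      using truncation_domination[OF c(1) lev c(2), of "u w"] by (simp add: \<xi>_def r_def)
    then show ?thesis by (metis norm_ge_zero power_mono power_mult_distrib)
  qed
  have bias: "norm (\<xi> w - (u w - m)) \<le> e * ?Z w" for w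
    using truncation_bias[OF c(1) lev c(2), of "u w"] by (simp add: \<xi>_def e_def)
  show "(\<integral>\<^sup>+w. ennreal (exp (2 / B\<^sup>2 * (norm (\<xi> w))\<^sup>2)) \<partial>M) \<le> ennreal (exp (32/5 * r\<^sup>2 * v / B\<^sup>2))"
    using dom bound B by (intro nn_exp_moment_square[OF B var]) (auto intro: power_mono)
  assume d: "norm d \<le> 1"
  have apply_le: "\<bar>blinfun_apply f d\<bar> \<le> norm f" for f :: "'b \<Rightarrow>\<^sub>L real"
    using norm_blinfun[of f d] mult_left_mono[OF d norm_ge_zero[of f]] by simp
  have bl: "bounded_linear (\<lambda>f :: 'b \<Rightarrow>\<^sub>L real. blinfun_apply f d)"
    by (rule blinfun.bounded_linear_left)
  show "(\<integral>\<^sup>+w. ennreal (exp (2 / B * blinfun_apply (\<xi> w) d)) \<partial>M)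
      \<le> ennreal (exp (2 * e * v / B + 22/5 * r\<^sup>2 * v / B\<^sup>2))"
  proof (rule nn_exp_moment_biased[OF B var, where T = "\<lambda>w. blinfun_apply (u w - m) d"])
    have int: "integrable M (\<lambda>w. u w - m)" using u(1) by simp
    show "integrable M (\<lambda>w. blinfun_apply (u w - m) d)"
      by (rule integrable_bounded_linear[OF bl int])
    have "expectation (\<lambda>w. blinfun_apply (u w - m) d) = blinfun_apply (expectation (\<lambda>w. u w - m)) d"
      by (rule integral_bounded_linear[OF bl int])
    also have "\<dots> = 0" using u by (simp add: prob_space)
    finally show "expectation (\<lambda>w. blinfun_apply (u w - m) d) = 0" .
    fix w
    show "\<bar>blinfun_apply (\<xi> w) d\<bar> \<le> B" using apply_le[of "\<xi> w"] bound[of w] by linarith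
    have "(blinfun_apply (\<xi> w) d)\<^sup>2 \<le> (norm (\<xi> w))\<^sup>2"
      using apply_le[of "\<xi> w"] by (simp flip: abs_le_square_iff)
    then show "(blinfun_apply (\<xi> w) d)\<^sup>2 \<le> r\<^sup>2 * ?Z w" using dom[of w] by linarith
    have "blinfun_apply (\<xi> w - (u w - m)) d \<le> e * ?Z w"
      using apply_le[of "\<xi> w - (u w - m)"] bias[of w] by linarith
    then show "blinfun_apply (\<xi> w) d \<le> blinfun_apply (u w - m) d + e * ?Z w"
      by (simp add: blinfun.diff_left)
  qed (use e in simp_all)
qed

section \<open>Tail bounds for adapted sums\<close>

text \<open>
  Independent identically distributed samples, numbered from 1, with the filtration \<open>past\<close> that they
  generate. The sample independent of \<open>past k\<close> is thus the one with index \<open>Suc k\<close>.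
\<close>

locale noise_sequence = prob_space S for S :: "'s measure" +
  fixes P :: "'w measure" and \<omega> :: "nat \<Rightarrow> 's \<Rightarrow> 'w"
  assumes indep: "indep_vars (\<lambda>_. P) \<omega> {1..}"
    and distribution: "\<And>i. i \<ge> 1 \<Longrightarrow> distr S P (\<omega> i) = P"
begin

definition past :: "nat \<Rightarrow> 's measure" where
  "past k = vimage_algebra (space S) (\<lambda>s. \<lambda>j\<in>{1..k}. \<omega> j s) (PiM {1..k} (\<lambda>_. P))"

lemma noise_measurable: "i \<ge> 1 \<Longrightarrow> \<omega> i \<in> S \<rightarrow>\<^sub>M P"
  using indep by (auto simp: indep_vars_def)

lemma space_past [simp]: "space (past k) = space S"
  by (simp add: past_def)

lemma history_space: "(\<lambda>s. \<lambda>j\<in>{1..k}. \<omega> j s) \<in> space S \<rightarrow> space (PiM {1..k} (\<lambda>_. P))"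
  using noise_measurable by (auto simp: space_PiM intro: measurable_space)

lemma noise_past:
  assumes "1 \<le> j" "j \<le> k"
  shows "\<omega> j \<in> past k \<rightarrow>\<^sub>M P"
proof -
  have "(\<lambda>s. \<lambda>j\<in>{1..k}. \<omega> j s) \<in> past k \<rightarrow>\<^sub>M PiM {1..k} (\<lambda>_. P)"
    unfolding past_def by (rule measurable_vimage_algebra1[OF history_space])
  from measurable_compose[OF this measurable_component_singleton[of j]] assms
  show ?thesis by (simp cong: measurable_cong)
qed

text \<open>
  The \<open>k\<close>-th past is the smallest sigma-algebra for the first \<open>k\<close> samples. The instances needed for \<open>M\<close> are
  later pasts and the whole space.
\<close>

lemma past_le:
  assumes f: "f \<in> past k \<rightarrow>\<^sub>M K" and M: "\<And>j. 1 \<le> j \<Longrightarrow> j \<le> k \<Longrightarrow> \<omega> j \<in> M \<rightarrow>\<^sub>M P" "space M = space S"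
  shows "f \<in> M \<rightarrow>\<^sub>M K"
proof -
  have "(\<lambda>s. s) \<in> M \<rightarrow>\<^sub>M past k"
    unfolding past_def using M by (intro measurable_vimage_algebra2 measurable_restrict) auto
  from measurable_compose[OF this f] show ?thesis by simp
qed

lemma past_mono: "f \<in> past k \<rightarrow>\<^sub>M K \<Longrightarrow> k \<le> m \<Longrightarrow> f \<in> past m \<rightarrow>\<^sub>M K"
  by (erule past_le) (auto intro: noise_past)

lemma past_measurable: "f \<in> past k \<rightarrow>\<^sub>M K \<Longrightarrow> f \<in> S \<rightarrow>\<^sub>M K"
  by (erule past_le) (auto intro: noise_measurable)

text \<open>
  The event \<open>T \<in> A\<close> is an event of the vector of the first \<open>k\<close> samples, which is independent of the next one.
\<close>

lemma prob_past_next_noise: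
  assumes T: "T \<in> past k \<rightarrow>\<^sub>M K" and A: "A \<in> sets K" and B: "B \<in> sets P"
  shows "prob (T -` A \<inter> \<omega> (Suc k) -` B \<inter> space S)
    = prob (T -` A \<inter> space S) * prob (\<omega> (Suc k) -` B \<inter> space S)"
proof -
  let ?H = "\<lambda>s. \<lambda>j\<in>{1..k}. \<omega> j s" and ?N = "\<lambda>s. \<lambda>j\<in>{Suc k}. \<omega> j s"
  have "T -` A \<inter> space S \<in> sets (past k)"
    using measurable_sets[OF T A] by simp
  then obtain C where C: "C \<in> sets (PiM {1..k} (\<lambda>_. P))" "T -` A \<inter> space S = ?H -` C \<inter> space S"
    using sets_vimage_algebra2[OF history_space] by (auto simp: past_def)
  define B' where "B' = (\<lambda>h. h (Suc k)) -` B \<inter> space (PiM {Suc k} (\<lambda>_. P))"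
  have "(\<lambda>h. h (Suc k)) \<in> PiM {Suc k} (\<lambda>_. P) \<rightarrow>\<^sub>M P"
    by (rule measurable_component_singleton) simp
  then have B': "B' \<in> sets (PiM {Suc k} (\<lambda>_. P))"
    unfolding B'_def using B by (rule measurable_sets)
  have N_B': "?N -` B' \<inter> space S = \<omega> (Suc k) -` B \<inter> space S"
    using noise_measurable[of "Suc k"] by (auto simp: B'_def space_PiM intro: measurable_space)
  have "indep_var (PiM {1..k} (\<lambda>_. P)) ?H (PiM {Suc k} (\<lambda>_. P)) ?N"
    by (rule indep_var_restrict[OF indep]) auto
  from indep_varD[OF this C(1) B']
  have "prob ((\<lambda>s. (?H s, ?N s)) -` (C \<times> B') \<inter> space S) = prob (?H -` C \<inter> space S) * prob (?N -` B' \<inter> space S)" .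
  moreover have "(\<lambda>s. (?H s, ?N s)) -` (C \<times> B') \<inter> space S = (?H -` C \<inter> space S) \<inter> (?N -` B' \<inter> space S)"
    by auto
  moreover have "T -` A \<inter> \<omega> (Suc k) -` B \<inter> space S = (T -` A \<inter> space S) \<inter> (\<omega> (Suc k) -` B \<inter> space S)"
    by auto
  ultimately show ?thesis
    by (simp only: C(2) N_B')
qed

lemma joint_distribution_past_next_noise:
  assumes T: "T \<in> past k \<rightarrow>\<^sub>M K"
  shows "distr S K T \<Otimes>\<^sub>M P = distr S (K \<Otimes>\<^sub>M P) (\<lambda>s. (T s, \<omega> (Suc k) s))"
proof -
  have T' [measurable]: "T \<in> S \<rightarrow>\<^sub>M K" by (rule past_measurable[OF T])
  have \<omega> [measurable]: "\<omega> (Suc k) \<in> S \<rightarrow>\<^sub>M P" by (rule noise_measurable) simp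
  interpret P: prob_space P
    using prob_space_distr[OF noise_measurable[of 1]] distribution[of 1] by simp
  interpret T: prob_space "distr S K T" by (rule prob_space_distr) measurable
  show ?thesis
  proof (rule pair_measure_eqI)
    fix A B assume "A \<in> sets (distr S K T)" "B \<in> sets P"
    then have A [measurable]: "A \<in> sets K" and B [measurable]: "B \<in> sets P" by simp_all
    have "emeasure P B = emeasure S (\<omega> (Suc k) -` B \<inter> space S)"
      using emeasure_distr[OF \<omega> B] distribution[of "Suc k"] by simp
    moreover have "(\<lambda>s. (T s, \<omega> (Suc k) s)) -` (A \<times> B) \<inter> space S = T -` A \<inter> \<omega> (Suc k) -` B \<inter> space S"
      by auto
    ultimately show "emeasure (distr S K T) A * emeasure P B
        = emeasure (distr S (K \<Otimes>\<^sub>M P) (\<lambda>s. (T s, \<omega> (Suc k) s))) (A \<times> B)"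
      using prob_past_next_noise[OF T A B]
      by (simp add: emeasure_distr emeasure_eq_measure ennreal_mult')
  qed (simp_all add: P.sigma_finite_measure_axioms T.sigma_finite_measure_axioms)
qed

text \<open>
  Conditioning on the past: the next sample may be integrated out while a function of the past is kept
  fixed. This replaces conditional expectations in the tail bound below.
\<close>

lemma nn_integral_freeze_past:
  assumes T: "T \<in> past k \<rightarrow>\<^sub>M K" and f [measurable]: "f \<in> borel_measurable (K \<Otimes>\<^sub>M P)"
  shows "(\<integral>\<^sup>+s. f (T s, \<omega> (Suc k) s) \<partial>S) = (\<integral>\<^sup>+s. (\<integral>\<^sup>+w. f (T s, w) \<partial>P) \<partial>S)"
proof -
  have T' [measurable]: "T \<in> S \<rightarrow>\<^sub>M K" by (rule past_measurable[OF T])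
  have [measurable]: "\<omega> (Suc k) \<in> S \<rightarrow>\<^sub>M P" by (rule noise_measurable) simp
  interpret P: prob_space P
    using prob_space_distr[OF noise_measurable[of 1]] distribution[of 1] by simp
  interpret T: prob_space "distr S K T" by (rule prob_space_distr) measurable
  have "(\<integral>\<^sup>+s. f (T s, \<omega> (Suc k) s) \<partial>S) = (\<integral>\<^sup>+z. f z \<partial>distr S (K \<Otimes>\<^sub>M P) (\<lambda>s. (T s, \<omega> (Suc k) s)))"
    by (simp add: nn_integral_distr)
  also have "distr S (K \<Otimes>\<^sub>M P) (\<lambda>s. (T s, \<omega> (Suc k) s)) = distr S K T \<Otimes>\<^sub>M P"
    by (rule joint_distribution_past_next_noise[OF T, symmetric])
  also have "(\<integral>\<^sup>+z. f z \<partial>(distr S K T \<Otimes>\<^sub>M P)) = (\<integral>\<^sup>+t. (\<integral>\<^sup>+w. f (t, w) \<partial>P) \<partial>distr S K T)"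
    by (rule P.nn_integral_fst[symmetric]) simp
  also have "\<dots> = (\<integral>\<^sup>+s. (\<integral>\<^sup>+w. f (T s, w) \<partial>P) \<partial>S)"
    by (rule nn_integral_distr) measurable
  finally show ?thesis .
qed

text \<open>
  The process \<open>exp (U m - m c)\<close> of partial sums is a nonnegative supermartingale that starts at 1, so Markov's
  inequality applies to its last value.
\<close>

theorem adapted_sum_tail:
  fixes f :: "'k \<times> 'w \<Rightarrow> real"
  assumes f [measurable]: "f \<in> borel_measurable (K \<Otimes>\<^sub>M P)"
    and T: "\<And>i. i < n \<Longrightarrow> T i \<in> past i \<rightarrow>\<^sub>M K"
    and moment: "\<And>i s. i < n \<Longrightarrow> s \<in> space S \<Longrightarrow>
      (\<integral>\<^sup>+w. ennreal (exp (f (T i s, w))) \<partial>P) \<le> ennreal (exp c)"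
  shows "prob {s \<in> space S. (\<Sum>i<n. f (T i s, \<omega> (Suc i) s)) > real n * c + \<tau>} \<le> exp (- \<tau>)"
proof -
  define U where "U m s = (\<Sum>i<m. f (T i s, \<omega> (Suc i) s))" for m s
  have U: "U m \<in> borel_measurable (past m)" if "m \<le> n" for m
    unfolding U_def
  proof (rule borel_measurable_sum)
    fix i assume "i \<in> {..<m}"
    then have [measurable]: "T i \<in> past m \<rightarrow>\<^sub>M K" "\<omega> (Suc i) \<in> past m \<rightarrow>\<^sub>M P"
      using T[of i] that by (auto intro: past_mono noise_past)
    show "(\<lambda>s. f (T i s, \<omega> (Suc i) s)) \<in> borel_measurable (past m)" by measurable
  qed
  have le_1: "(\<integral>\<^sup>+s. ennreal (exp (U m s - real m * c)) \<partial>S) \<le> 1" if "m \<le> n" for m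
    using that
  proof (induction m)
    case 0
    then show ?case by (simp add: U_def emeasure_space_1)
  next
    case (Suc m)
    have [measurable]: "(\<lambda>s. (U m s, T m s)) \<in> past m \<rightarrow>\<^sub>M borel \<Otimes>\<^sub>M K"
      using U[of m] T[of m] Suc.prems by simp
    define g where "g = (\<lambda>z. ennreal (exp (fst (fst z) - real m * c - c)) * ennreal (exp (f (snd (fst z), snd z))))"
    have [measurable]: "g \<in> borel_measurable ((borel \<Otimes>\<^sub>M K) \<Otimes>\<^sub>M P)"
      unfolding g_def by measurable
    have "(\<integral>\<^sup>+s. ennreal (exp (U (Suc m) s - real (Suc m) * c)) \<partial>S)
        = (\<integral>\<^sup>+s. g ((U m s, T m s), \<omega> (Suc m) s) \<partial>S)"
      by (intro nn_integral_cong)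
        (simp add: g_def U_def algebra_simps flip: ennreal_mult' exp_add)
    also have "\<dots> = (\<integral>\<^sup>+s. (\<integral>\<^sup>+w. g ((U m s, T m s), w) \<partial>P) \<partial>S)"
      by (rule nn_integral_freeze_past) measurable
    also have "\<dots> \<le> (\<integral>\<^sup>+s. ennreal (exp (U m s - real m * c)) \<partial>S)"
    proof (rule nn_integral_mono)
      fix s assume s: "s \<in> space S"
      have "T m s \<in> space K" using measurable_space[OF T[of m]] Suc.prems s by simp
      then have [measurable]: "(\<lambda>w. f (T m s, w)) \<in> borel_measurable P" by measurable
      have "(\<integral>\<^sup>+w. g ((U m s, T m s), w) \<partial>P)
          = ennreal (exp (U m s - real m * c - c)) * (\<integral>\<^sup>+w. ennreal (exp (f (T m s, w))) \<partial>P)"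
        by (simp add: g_def nn_integral_cmult)
      also have "\<dots> \<le> ennreal (exp (U m s - real m * c - c)) * ennreal (exp c)"
        using moment[of m s] Suc.prems s by (intro mult_left_mono) auto
      also have "\<dots> = ennreal (exp (U m s - real m * c))"
        by (simp flip: ennreal_mult' exp_add)
      finally show "(\<integral>\<^sup>+w. g ((U m s, T m s), w) \<partial>P) \<le> ennreal (exp (U m s - real m * c))" .
    qed
    finally show ?case using Suc by simp
  qed
  have [measurable]: "U n \<in> borel_measurable S" by (rule past_measurable[OF U]) simp
  let ?A = "{s \<in> space S. U n s > real n * c + \<tau>}"
  have "emeasure S ?A
      \<le> emeasure S {s \<in> space S. 1 \<le> ennreal (exp (- \<tau>)) * ennreal (exp (U n s - real n * c))}"
    by (intro emeasure_mono) (auto simp flip: ennreal_mult' exp_add)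
  also have "\<dots> \<le> ennreal (exp (- \<tau>)) * (\<integral>\<^sup>+s. ennreal (exp (U n s - real n * c)) * indicator (space S) s \<partial>S)"
    by (intro nn_integral_Markov_inequality) auto
  also have "(\<integral>\<^sup>+s. ennreal (exp (U n s - real n * c)) * indicator (space S) s \<partial>S)
      = (\<integral>\<^sup>+s. ennreal (exp (U n s - real n * c)) \<partial>S)"
    by (intro nn_integral_cong) auto
  also have "ennreal (exp (- \<tau>)) * \<dots> \<le> ennreal (exp (- \<tau>)) * 1"
    using le_1[of n] by (intro mult_left_mono) auto
  finally show ?thesis
    by (simp add: emeasure_eq_measure U_def)
qed

end

section \<open>Certificates and optimality gap\<close>

lemma has_real_derivative_along_segment:
  fixes \<phi> :: "'a::real_normed_vector \<Rightarrow> real"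
  assumes X: "convex X" "x \<in> X" "z \<in> X" and r: "r \<in> {0..1}"
    and deriv: "(\<phi> has_derivative A) (at (x + r *\<^sub>R (z - x)) within X)"
  shows "((\<lambda>r. \<phi> (x + r *\<^sub>R (z - x))) has_real_derivative A (z - x)) (at r within {0..1})"
proof -
  let ?p = "\<lambda>r. x + r *\<^sub>R (z - x)"
  have "?p ` {0..1} \<subseteq> X"
  proof safe
    fix r :: real assume "r \<in> {0..1}"
    moreover have "?p r = (1 - r) *\<^sub>R x + r *\<^sub>R z" by (simp add: algebra_simps)
    ultimately show "?p r \<in> X" using convexD[OF X(1)] X by auto
  qed
  then have "(\<phi> has_derivative A) (at (?p r) within ?p ` {0..1})"
    using deriv has_derivative_subset by blast
  moreover have "(?p has_derivative (\<lambda>h. h *\<^sub>R (z - x))) (at r within {0..1})"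
    by (auto intro!: derivative_eq_intros)
  ultimately have "((\<lambda>r. \<phi> (?p r)) has_derivative (\<lambda>h. A (h *\<^sub>R (z - x)))) (at r within {0..1})"
    by (rule has_derivative_in_compose[rotated])
  moreover have "A (h *\<^sub>R (z - x)) = A (z - x) * h" for h
    using linear_scale[OF bounded_linear.linear[OF has_derivative_bounded_linear[OF deriv]]] by simp
  ultimately show ?thesis by (simp add: has_field_derivative_def)
qed

lemma convex_gradient_inequality:
  fixes \<phi> :: "'a::real_normed_vector \<Rightarrow> real"
  assumes "convex_on X \<phi>" "x \<in> X" "z \<in> X" and deriv: "(\<phi> has_derivative A) (at x within X)"
  shows "\<phi> x + A (z - x) \<le> \<phi> z"
proof -
  let ?g = "\<lambda>r. \<phi> (x + r *\<^sub>R (z - x))"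
  have "(?g has_real_derivative A (z - x)) (at 0 within {0..1})"
    using assms convex_on_imp_convex by (intro has_real_derivative_along_segment[of X]) auto
  then have "((\<lambda>r. (?g r - \<phi> x) / r) \<longlongrightarrow> A (z - x)) (at_right 0)"
    by (simp add: has_field_derivative_iff at_within_Icc_at_right)
  moreover have "\<forall>\<^sub>F r in at_right 0. (?g r - \<phi> x) / r \<le> \<phi> z - \<phi> x"
  proof (rule eventually_at_rightI[of 0 1])
    fix r :: real assume r: "r \<in> {0<..<1}"
    have "?g r = \<phi> ((1 - r) *\<^sub>R x + r *\<^sub>R z)" by (simp add: algebra_simps)
    also have "\<dots> \<le> (1 - r) * \<phi> x + r * \<phi> z"
      using r assms by (intro convex_onD[OF assms(1)]) auto
    finally show "(?g r - \<phi> x) / r \<le> \<phi> z - \<phi> x"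
      using r by (simp add: field_simps)
  qed simp
  ultimately have "A (z - x) \<le> \<phi> z - \<phi> x"
    by (rule tendsto_upperbound) simp
  then show ?thesis by simp
qed

text \<open>
  Subtracting the claimed quadratic bound along the segment from \<open>x\<close> to \<open>z\<close> leaves a function with
  nonpositive derivative.
\<close>

lemma descent_lemma:
  fixes \<phi> :: "'a::real_normed_vector \<Rightarrow> real"
  assumes X: "convex X" "x \<in> X" "z \<in> X"
    and deriv: "\<And>z. z \<in> X \<Longrightarrow> (\<phi> has_derivative blinfun_apply (D z)) (at z within X)"
    and lipschitz: "\<And>z z'. z \<in> X \<Longrightarrow> z' \<in> X \<Longrightarrow> norm (D z' - D z) \<le> L * norm (z - z')"
  shows "\<phi> z \<le> \<phi> x + blinfun_apply (D x) (z - x) + L / 2 * (norm (z - x))\<^sup>2"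
proof -
  define d where "d = z - x"
  define h where "h r = \<phi> (x + r *\<^sub>R (z - x)) - r * blinfun_apply (D x) d - L / 2 * (norm d)\<^sup>2 * r\<^sup>2" for r
  define h' where "h' r = blinfun_apply (D (x + r *\<^sub>R (z - x))) d - blinfun_apply (D x) d - L * (norm d)\<^sup>2 * r" for r
  have seg: "x + r *\<^sub>R (z - x) \<in> X" if "r \<in> {0..1}" for r
  proof -
    have "x + r *\<^sub>R (z - x) = (1 - r) *\<^sub>R x + r *\<^sub>R z" by (simp add: algebra_simps)
    then show ?thesis using convexD[OF X(1)] X that by auto
  qed
  have h_deriv: "(h has_real_derivative h' r) (at r within {0..1})" if r: "r \<in> {0..1}" for r
  proof -
    have "((\<lambda>r. \<phi> (x + r *\<^sub>R (z - x))) has_real_derivative blinfun_apply (D (x + r *\<^sub>R (z - x))) d)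
        (at r within {0..1})"
      unfolding d_def by (rule has_real_derivative_along_segment[OF X r deriv[OF seg[OF r]]])
    then show ?thesis
      unfolding h_def h'_def by (auto intro!: derivative_eq_intros)
  qed
  obtain r where r: "r \<in> {0<..<1}" "h 1 - h 0 = h' r * (1 - 0)"
    using mvt_simple[of 0 1 h "\<lambda>r k. h' r * k"] h_deriv by (auto simp: has_field_derivative_def)
  have "blinfun_apply (D (x + r *\<^sub>R (z - x)) - D x) d \<le> norm (D (x + r *\<^sub>R (z - x)) - D x) * norm d"
    using norm_blinfun[of "D (x + r *\<^sub>R (z - x)) - D x" d] by simp
  also have "\<dots> \<le> (L * norm (x - (x + r *\<^sub>R (z - x)))) * norm d"
    using r X seg[of r] by (intro mult_right_mono lipschitz) auto
  also have "\<dots> = L * (norm d)\<^sup>2 * r"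
    using r by (simp add: d_def power2_eq_square)
  finally have "h' r \<le> 0" by (simp add: h'_def blinfun.diff_left)
  then have "h 1 \<le> h 0" using r by simp
  then show ?thesis by (simp add: h_def d_def)
qed

text \<open>
  Scaling by \<open>R\<close> does not change the modulus of strong convexity.
\<close>

lemma bregman_growth:
  fixes x z :: "'a::finite_dim_normed_space"
  assumes proxy: "proxy_function \<theta> \<theta>'" and R: "R > 0"
    and x: "(x - x0) /\<^sub>R R \<in> subdiff_domain (cball 0 1) \<theta>" and z: "norm (z - x0) \<le> R"
  shows "(norm (z - x))\<^sup>2 / 2 \<le> bregman R x0 \<theta> \<theta>' x z"
proof -
  define u v where "u = (x - x0) /\<^sub>R R" and "v = (z - x0) /\<^sub>R R"
  have zx: "z - x = R *\<^sub>R (v - u)"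
    using R by (simp add: u_def v_def flip: scaleR_diff_right)
  have "norm v = norm (z - x0) / R" using R by (simp add: v_def divide_inverse mult.commute)
  then have "v \<in> cball 0 1" using z R by simp
  then have "\<theta> u + blinfun_apply (\<theta>' u) (v - u) + (norm (v - u))\<^sup>2 / 2 \<le> \<theta> v"
    using x proxy_grad_subgradient[of \<theta> \<theta>' u, OF proxy]
    by (intro proxy_growth[OF proxy]) (auto simp: u_def[symmetric] subdiff_domain_def)
  then have "R\<^sup>2 * ((norm (v - u))\<^sup>2 / 2) \<le> R\<^sup>2 * (\<theta> v - \<theta> u - blinfun_apply (\<theta>' u) (v - u))"
    by (intro mult_left_mono) auto
  also have "\<dots> = bregman R x0 \<theta> \<theta>' x z"
    unfolding bregman_def scaled_proxy_def scaled_proxy_grad_def u_def[symmetric] v_def[symmetric] zx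
    by (simp add: blinfun.scaleR_left blinfun.scaleR_right blinfun.diff_right power2_eq_square algebra_simps)
  finally show ?thesis
    using R by (simp add: zx power_mult_distrib)
qed

lemma certificate_bdd_above:
  fixes \<psi> :: "'a::real_normed_vector \<Rightarrow> real"
  assumes X: "compact X" and \<psi>: "continuous_on X \<psi>"
  shows "bdd_above ((\<lambda>z. \<Sum>i=1..N. blinfun_apply (g i) (x i - z) + \<psi> (x i) - \<psi> z + c i) ` X)"
  by (intro bounded_imp_bdd_above compact_imp_bounded compact_continuous_image continuous_intros X \<psi>)

lemma certificate_compare:
  assumes X: "compact X" "X \<noteq> {}" and \<psi>: "continuous_on X \<psi>" 
    and err: "\<And>z. z \<in> X \<Longrightarrow> (\<Sum>i=1..N. blinfun_apply (g i - g' i) (x i - z)) \<le> \<rho>"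
  shows "certificate X \<psi> V N t g x \<le> certificate X \<psi> V N t g' x + \<rho> / real N"
proof -
  let ?f = "\<lambda>g z. \<Sum>i=1..N. blinfun_apply (g i) (x i - z) + \<psi> (x i) - \<psi> z + t * V (x (i - 1)) (x i)"
  have "(SUP z\<in>X. ?f g z) \<le> (SUP z\<in>X. ?f g' z) + \<rho>"
  proof (rule cSUP_least[OF X(2)])
    fix z assume z: "z \<in> X"
    have "?f g z = ?f g' z + (\<Sum>i=1..N. blinfun_apply (g i - g' i) (x i - z))"
      unfolding sum.distrib[symmetric] by (intro sum.cong) (simp_all add: blinfun.diff_left)
    also have "\<dots> \<le> (SUP z\<in>X. ?f g' z) + \<rho>"
      using z by (intro add_mono err cSUP_upper certificate_bdd_above X \<psi>)
    finally show "?f g z \<le> (SUP z\<in>X. ?f g' z) + \<rho>" .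
  qed
  then show ?thesis
    unfolding certificate_def add_divide_distrib[symmetric] by (rule divide_right_mono) simp
qed

text \<open>
  By the descent lemma and the gradient inequality, each summand of the certificate bounds \<open>F (x i) - F z\<close>:
  the divergence with a factor at least \<open>L\<close> pays for the quadratic term. Jensen's inequality passes to the
  average.
\<close>

lemma certificate_bounds_gap:
  fixes X :: "'a::real_normed_vector set"
  assumes X: "X \<noteq> {}" "convex X" "compact X"
    and \<phi>: "convex_on X \<phi>" "\<And>z. z \<in> X \<Longrightarrow> (\<phi> has_derivative blinfun_apply (D z)) (at z within X)"
    and lipschitz: "\<And>z z'. z \<in> X \<Longrightarrow> z' \<in> X \<Longrightarrow> norm (D z' - D z) \<le> L * norm (z - z')"
    and \<psi>: "convex_on X \<psi>" "continuous_on X \<psi>"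
    and N: "N \<ge> 1" and x: "\<And>i. i \<le> N \<Longrightarrow> x i \<in> X"
    and V: "\<And>i. i \<in> {1..N} \<Longrightarrow> (norm (x i - x (i - 1)))\<^sup>2 / 2 \<le> V (x (i - 1)) (x i)"
    and t: "0 \<le> L" "L \<le> t"
    and F: "\<And>z. z \<in> X \<Longrightarrow> F z = \<phi> z + \<psi> z"
  shows "F ((\<Sum>i=1..N. x i) /\<^sub>R real N) - (INF z\<in>X. F z) \<le> certificate X \<psi> V N t (\<lambda>i. D (x (i - 1))) x"
    (is "F ?xhat - _ \<le> ?c")
proof -
  have xhat: "?xhat = (\<Sum>i\<in>{1..N}. (1 / real N) *\<^sub>R x i)"
    by (simp add: scaleR_sum_right inverse_eq_divide)
  have weights: "(\<Sum>i\<in>{1..N}. 1 / real N) = 1" using N by simp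
  have xhat_X: "?xhat \<in> X"
    unfolding xhat using x weights by (intro convex_sum X) auto
  have jensen: "f ?xhat \<le> (\<Sum>i=1..N. f (x i)) / real N" if "convex_on X f" for f
    using convex_on_sum[of "{1..N}" X f "\<lambda>_. 1 / real N" x] that x weights N
    unfolding xhat by (simp add: sum_divide_distrib convex_on_imp_convex)
  have "F ?xhat - ?c \<le> F z" if z: "z \<in> X" for z
  proof -
    have step: "F (x i) - F z
        \<le> blinfun_apply (D (x (i - 1))) (x i - z) + \<psi> (x i) - \<psi> z + t * V (x (i - 1)) (x i)"
      if i: "i \<in> {1..N}" for i
    proof -
      have xi: "x i \<in> X" "x (i - 1) \<in> X" using i x by auto
      have "\<phi> (x i) \<le> \<phi> (x (i - 1)) + blinfun_apply (D (x (i - 1))) (x i - x (i - 1))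
          + L / 2 * (norm (x i - x (i - 1)))\<^sup>2"
        by (rule descent_lemma[OF X(2) xi(2,1) \<phi>(2) lipschitz])
      moreover have "\<phi> (x (i - 1)) + blinfun_apply (D (x (i - 1))) (z - x (i - 1)) \<le> \<phi> z"
        by (rule convex_gradient_inequality[OF \<phi>(1) xi(2) z \<phi>(2)[OF xi(2)]])
      moreover have "L * ((norm (x i - x (i - 1)))\<^sup>2 / 2) \<le> t * V (x (i - 1)) (x i)"
        using t V[OF i] by (intro mult_mono) auto
      ultimately show ?thesis
        using F[OF xi(1)] F[OF z] by (simp add: blinfun.diff_right)
    qed
    have "real N * (F ?xhat - F z) \<le> (\<Sum>i=1..N. F (x i) - F z)"
      using jensen[OF \<phi>(1)] jensen[OF \<psi>(1)] N F[OF xhat_X] F x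
      by (simp add: sum_subtractf field_simps sum.distrib)
    also have "\<dots> \<le> (\<Sum>i=1..N. blinfun_apply (D (x (i - 1))) (x i - z) + \<psi> (x i) - \<psi> z + t * V (x (i - 1)) (x i))"
      by (rule sum_mono[OF step])
    also have "\<dots> \<le> real N * ?c"
      using cSUP_upper[OF z certificate_bdd_above[OF X(3) \<psi>(2),
          where c = "\<lambda>i. t * V (x (i - 1)) (x i)" and N = N and x = x and g = "\<lambda>i. D (x (i - 1))"]] N
      by (simp add: certificate_def)
    finally show ?thesis using N by (simp flip: mult.assoc)
  qed
  then have "F ?xhat - ?c \<le> (INF z\<in>X. F z)"
    by (intro cINF_greatest X)
  then show ?thesis by simp
qed

section \<open>The linear error of the observable certificate\<close>

text \<open>
  The deterministic part of the argument, on a trajectory on which the two tail bounds hold: the three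
  sums into which the linear error splits are bounded by the three terms of \<open>rho_bar\<close>.
\<close>

lemma linear_error_le_rho_bar:
  fixes x :: "nat \<Rightarrow> 'a::finite_dim_normed_space" and \<xi> :: "nat \<Rightarrow> 'a \<Rightarrow>\<^sub>L real"
  assumes proxy: "proxy_function \<theta> \<theta>'" and R: "R > 0" and \<tau>: "\<tau> > 0" and \<sigma>: "\<sigma> > 0" and M: "M \<ge> 0"
    and N: "N \<ge> 1"
    and z: "norm (z - x0) \<le> R"
    and V: "\<And>i. i \<in> {1..N} \<Longrightarrow> (norm (x i - x (i - 1)))\<^sup>2 / 2 \<le> V (x (i - 1)) (x i)"
  defines "l \<equiv> max (\<sigma> * sqrt (real N / \<tau>)) M"
  defines "\<eta> \<equiv> sqrt (proxy_range \<theta> / (20 * (\<tau> * l\<^sup>2)))"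
  defines "v \<equiv> \<lambda>i. mirror_map \<theta> (\<eta> *\<^sub>R (\<Sum>j=1..i. \<xi> j))"
  assumes square: "(\<Sum>i=1..N. (norm (\<xi> i))\<^sup>2) \<le> 40 * (\<tau> * l\<^sup>2)"
    and linear: "(\<Sum>i=1..N. blinfun_apply (\<xi> i) ((v (i - 1) - (x (i - 1) - x0) /\<^sub>R R) /\<^sub>R 2)) \<le> 8 * \<tau> * l"
  shows "(\<Sum>i=1..N. blinfun_apply (\<xi> i) (z - x i)) \<le> rho_bar R (proxy_range \<theta>) \<sigma> M V N \<tau> x"
proof -
  define K where "K = \<tau> * l\<^sup>2"
  define u where "u = (z - x0) /\<^sub>R R"
  define \<Theta> where "\<Theta> = proxy_range \<theta>"
  have a_pos: "\<sigma> * sqrt (real N / \<tau>) > 0" using \<sigma> N \<tau> by simp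
  then have l: "l > 0" by (simp add: l_def less_max_iff_disj)
  have K: "K > 0" using l \<tau> by (simp add: K_def)
  have K_eq: "max (real N * \<sigma>\<^sup>2) (M\<^sup>2 * \<tau>) = K"
  proof -
    have "l\<^sup>2 = max ((\<sigma> * sqrt (real N / \<tau>))\<^sup>2) (M\<^sup>2)"
      using a_pos M by (auto simp: l_def max_def power_mono)
    then have "K = max (\<tau> * (\<sigma> * sqrt (real N / \<tau>))\<^sup>2) (\<tau> * M\<^sup>2)"
      using \<tau> by (simp add: K_def max_mult_distrib_left)
    then show ?thesis using \<tau> by (simp add: power_mult_distrib mult_ac)
  qed
  have l_eq: "max (\<sigma> * sqrt (real N * \<tau>)) (M * \<tau>) = \<tau> * l"
  proof -
    have "\<tau> * (\<sigma> * sqrt (real N / \<tau>)) = \<sigma> * (sqrt (real N) * (\<tau> / sqrt \<tau>))"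
      by (simp add: real_sqrt_divide)
    also have "\<tau> / sqrt \<tau> = sqrt \<tau>" using \<tau> by (simp add: real_div_sqrt)
    finally have "\<tau> * (\<sigma> * sqrt (real N / \<tau>)) = \<sigma> * sqrt (real N * \<tau>)" by (simp add: real_sqrt_mult)
    moreover have "\<tau> * l = max (\<tau> * (\<sigma> * sqrt (real N / \<tau>))) (\<tau> * M)"
      using \<tau> by (simp add: l_def max_mult_distrib_left)
    ultimately show ?thesis by (simp only: mult.commute)
  qed
  have "norm u = norm (z - x0) / R" using R by (simp add: u_def divide_inverse mult.commute)
  then have u: "u \<in> cball 0 1" using z R by simp
  have regret: "(\<Sum>i=1..N. blinfun_apply (\<xi> i) (u - v (i - 1))) \<le> 4 * sqrt (5 * \<Theta> * K)"
  proof (cases "\<Theta> > 0")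
    case True
    define q where "q = sqrt (20 * \<Theta> * K)"
    have q: "q > 0" "q * q = 20 * \<Theta> * K" using True K by (simp_all add: q_def)
    have \<eta>: "\<eta> = q / (20 * K)"
      using q(1) K True unfolding \<eta>_def q_def K_def[symmetric] \<Theta>_def[symmetric]
      by (simp add: real_sqrt_divide real_sqrt_mult real_div_sqrt field_simps)
    have \<eta>': "\<Theta> / \<eta> = q" using q K unfolding \<eta> by (simp add: field_simps)
    have "\<eta> > 0" using q K by (simp add: \<eta>)
    then have "(\<Sum>i=1..N. blinfun_apply (\<xi> i) (u - v (i - 1))) \<le> \<Theta> / \<eta> + \<eta> / 2 * (\<Sum>i=1..N. (norm (\<xi> i))\<^sup>2)"
      unfolding v_def \<Theta>_def by (intro dual_averaging_regret[OF proxy _ u])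
    also have "\<dots> \<le> \<Theta> / \<eta> + \<eta> / 2 * (40 * K)"
      using square \<open>\<eta> > 0\<close> by (intro add_left_mono mult_left_mono) (auto simp: K_def)
    also have "\<dots> = 2 * q" unfolding \<eta>' using K by (simp add: \<eta>)
    also have "\<dots> = 4 * sqrt (5 * \<Theta> * K)"
      using real_sqrt_mult[of 4 "5 * \<Theta> * K"] by (simp add: q_def mult.assoc)
    finally show ?thesis .
  next
    \<comment> \<open>Then the space is trivial, \<open>\<eta> = 0\<close>, and the regret bound with its division by \<open>\<eta>\<close> is replaced by equality.\<close>
    case False
    then have "y = 0" for y :: 'a using proxy_range_pos[OF proxy, of y] by (auto simp: \<Theta>_def)
    then have "u - v i = 0" for i by blast
    moreover have "\<Theta> = 0" using False proxy_range_nonneg[OF proxy] by (simp add: \<Theta>_def)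
    ultimately show ?thesis by simp
  qed
  have bregman: "(\<Sum>i=1..N. blinfun_apply (\<xi> i) (x (i - 1) - x i))
      \<le> 20 * \<mu> * K + inverse \<mu> * (\<Sum>i=1..N. V (x (i - 1)) (x i))" if \<mu>: "\<mu> > 0" for \<mu>
  proof -
    have "blinfun_apply (\<xi> i) (x (i - 1) - x i) \<le> \<mu> / 2 * (norm (\<xi> i))\<^sup>2 + inverse \<mu> * V (x (i - 1)) (x i)"
      if i: "i \<in> {1..N}" for i
    proof -
      define n where "n = norm (x i - x (i - 1))"
      have "blinfun_apply (\<xi> i) (x (i - 1) - x i) \<le> norm (\<xi> i) * n"
        using norm_blinfun[of "\<xi> i" "x (i - 1) - x i"] by (simp add: n_def norm_minus_commute)
      also have "norm (\<xi> i) * n = sqrt \<mu> * norm (\<xi> i) * (n / sqrt \<mu>)" using \<mu> by simp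
      also have "2 * \<dots> \<le> (sqrt \<mu> * norm (\<xi> i))\<^sup>2 + (n / sqrt \<mu>)\<^sup>2"
        using sum_squares_bound[of "sqrt \<mu> * norm (\<xi> i)" "n / sqrt \<mu>"] by (simp only: mult.assoc)
      finally have "blinfun_apply (\<xi> i) (x (i - 1) - x i) \<le> \<mu> / 2 * (norm (\<xi> i))\<^sup>2 + inverse \<mu> * (n\<^sup>2 / 2)"
        using \<mu> by (simp add: power_mult_distrib power_divide inverse_eq_divide field_simps)
      also have "inverse \<mu> * (n\<^sup>2 / 2) \<le> inverse \<mu> * V (x (i - 1)) (x i)"
        using V[OF i] \<mu> by (intro mult_left_mono) (auto simp: n_def)
      finally show ?thesis by simp
    qed
    then have "(\<Sum>i=1..N. blinfun_apply (\<xi> i) (x (i - 1) - x i))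
        \<le> (\<Sum>i=1..N. \<mu> / 2 * (norm (\<xi> i))\<^sup>2 + inverse \<mu> * V (x (i - 1)) (x i))"
      by (rule sum_mono)
    also have "\<dots> = \<mu> / 2 * (\<Sum>i=1..N. (norm (\<xi> i))\<^sup>2) + inverse \<mu> * (\<Sum>i=1..N. V (x (i - 1)) (x i))"
      by (simp add: sum.distrib sum_distrib_left)
    also have "\<mu> / 2 * (\<Sum>i=1..N. (norm (\<xi> i))\<^sup>2) \<le> \<mu> / 2 * (40 * K)"
      using square \<mu> by (intro mult_left_mono) (auto simp: K_def)
    finally show ?thesis by (simp add: mult.commute mult.left_commute)
  qed
  have "z - x i = R *\<^sub>R (u - v (i - 1)) + (2 * R) *\<^sub>R ((v (i - 1) - (x (i - 1) - x0) /\<^sub>R R) /\<^sub>R 2) + (x (i - 1) - x i)" for i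
    using R by (simp add: u_def algebra_simps)
  then have split: "(\<Sum>i=1..N. blinfun_apply (\<xi> i) (z - x i))
      = R * (\<Sum>i=1..N. blinfun_apply (\<xi> i) (u - v (i - 1)))
        + 2 * R * (\<Sum>i=1..N. blinfun_apply (\<xi> i) ((v (i - 1) - (x (i - 1) - x0) /\<^sub>R R) /\<^sub>R 2))
        + (\<Sum>i=1..N. blinfun_apply (\<xi> i) (x (i - 1) - x i))"
    unfolding sum_distrib_left sum.distrib[symmetric]
    by (intro sum.cong) (simp_all only: blinfun.add_right blinfun.scaleR_right real_scaleR_def)
  have "(\<Sum>i=1..N. blinfun_apply (\<xi> i) (z - x i)) - (R * (4 * sqrt (5 * \<Theta> * K)) + 2 * R * (8 * \<tau> * l))
      \<le> (INF \<mu>\<in>{0<..}. 20 * \<mu> * K + inverse \<mu> * (\<Sum>i=1..N. V (x (i - 1)) (x i)))"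
  proof (rule cINF_greatest)
    fix \<mu> :: real assume "\<mu> \<in> {0<..}"
    then have "(\<Sum>i=1..N. blinfun_apply (\<xi> i) (x (i - 1) - x i))
      \<le> 20 * \<mu> * K + inverse \<mu> * (\<Sum>i=1..N. V (x (i - 1)) (x i))" by (intro bregman) simp
    moreover have "R * (\<Sum>i=1..N. blinfun_apply (\<xi> i) (u - v (i - 1))) \<le> R * (4 * sqrt (5 * \<Theta> * K))"
      using regret R by (intro mult_left_mono) auto
    moreover have "2 * R * (\<Sum>i=1..N. blinfun_apply (\<xi> i) ((v (i - 1) - (x (i - 1) - x0) /\<^sub>R R) /\<^sub>R 2))
        \<le> 2 * R * (8 * \<tau> * l)"
      using linear R by (intro mult_left_mono) auto
    ultimately show "(\<Sum>i=1..N. blinfun_apply (\<xi> i) (z - x i)) - (R * (4 * sqrt (5 * \<Theta> * K)) + 2 * R * (8 * \<tau> * l))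
      \<le> 20 * \<mu> * K + inverse \<mu> * (\<Sum>i=1..N. V (x (i - 1)) (x i))"
      unfolding split by linarith
  qed simp
  then show ?thesis
    unfolding rho_bar_def K_eq l_eq \<Theta>_def by (simp add: mult_ac)
qed

section \<open>Measurability\<close>

text \<open>
  The arguments of the \<open>i\<close>-th search rule involve earlier search points only, so a strong induction
  turns the recursive dependence into dependence on the samples.
\<close>

lemma (in noise_sequence) search_points_adapted:
  fixes x :: "nat \<Rightarrow> 's \<Rightarrow> 'a::second_countable_topology"
  assumes x: "search_points S P \<omega> X x0 N x" and i: "i \<le> N"
  shows "x i \<in> borel_measurable (past i)"
  using i
proof (induction i rule: less_induct)
  case (less i)
  show ?case
  proof (cases "i = 0")
    case True
    have "x 0 s = x0" if "s \<in> space (past 0)" for s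
      using x that by (simp add: search_points_def)
    then have "x 0 \<in> borel_measurable (past 0) \<longleftrightarrow> (\<lambda>_. x0) \<in> borel_measurable (past 0)"
      by (intro measurable_cong)
    then show ?thesis using True by simp
  next
    case False
    then have "i \<in> {1..N}" using less.prems by simp
    then obtain A where A: "A \<in> PiM {1..i} (\<lambda>_. borel \<Otimes>\<^sub>M P) \<rightarrow>\<^sub>M borel"
      "\<And>s. s \<in> space S \<Longrightarrow> x i s = A (\<lambda>j\<in>{1..i}. (x (j - 1) s, \<omega> j s))"
      using x unfolding search_points_def by blast
    have "(\<lambda>s. \<lambda>j\<in>{1..i}. (x (j - 1) s, \<omega> j s)) \<in> past i \<rightarrow>\<^sub>M PiM {1..i} (\<lambda>_. borel \<Otimes>\<^sub>M P)"
    proof (intro measurable_restrict measurable_Pair)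
      fix j assume j: "j \<in> {1..i}"
      then show "\<omega> j \<in> past i \<rightarrow>\<^sub>M P" by (intro noise_past) auto
      show "x (j - 1) \<in> borel_measurable (past i)"
        using j less.prems by (intro past_mono[OF less.IH]) auto
    qed
    from measurable_compose[OF this A(1)] show ?thesis
      by (subst measurable_cong[OF A(2)]) simp_all
  qed
qed

text \<open>
  The closed form shows that \<open>rho_bar\<close> is a measurable function of the trajectory. For \<open>b = 0\<close> the infimum is
  not attained.
\<close>

lemma INF_linear_plus_inverse:
  assumes a: "a > 0" and b: "(b::real) \<ge> 0"
  shows "(INF \<mu>\<in>{0<..}. a * \<mu> + inverse \<mu> * b) = 2 * sqrt (a * b)"
proof (rule antisym)
  have amgm: "2 * sqrt (a * b) \<le> a * \<mu> + inverse \<mu> * b" if "\<mu> > 0" for \<mu>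
  proof -
    have "2 * sqrt (a * \<mu>) * sqrt (inverse \<mu> * b) \<le> a * \<mu> + inverse \<mu> * b"
      using sum_squares_bound[of "sqrt (a * \<mu>)" "sqrt (inverse \<mu> * b)"] that a b by simp
    moreover have "sqrt (a * \<mu>) * sqrt (inverse \<mu> * b) = sqrt (a * b)"
      using that by (simp flip: real_sqrt_mult)
    ultimately show ?thesis by simp
  qed
  then show "2 * sqrt (a * b) \<le> (INF \<mu>\<in>{0<..}. a * \<mu> + inverse \<mu> * b)"
    by (intro cINF_greatest) auto
  have bdd: "bdd_below ((\<lambda>\<mu>. a * \<mu> + inverse \<mu> * b) ` {0<..})"
    using amgm by (intro bdd_belowI2) auto
  show "(INF \<mu>\<in>{0<..}. a * \<mu> + inverse \<mu> * b) \<le> 2 * sqrt (a * b)"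
  proof (cases "b = 0")
    case True
    show ?thesis
    proof (rule field_le_epsilon)
      fix e :: real assume "e > 0"
      then show "(INF \<mu>\<in>{0<..}. a * \<mu> + inverse \<mu> * b) \<le> 2 * sqrt (a * b) + e"
        using a True by (intro cINF_lower2[OF bdd, of "e / a"]) auto
    qed
  next
    case False
    define \<mu> where "\<mu> = sqrt (b / a)"
    have "\<mu> > 0" using a b False by (simp add: \<mu>_def)
    have "a * \<mu> = sqrt (a * b)" "inverse \<mu> * b = sqrt (a * b)"
      using a b False by (simp_all add: \<mu>_def real_sqrt_mult real_sqrt_divide real_sqrt_inverse field_simps)
    then show ?thesis using \<open>\<mu> > 0\<close> by (intro cINF_lower2[OF bdd, of \<mu>]) auto
  qed
qed

text \<open>
  The part of a certificate that involves the supremum over \<open>z\<close>. It depends on the linear forms only through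
  their sum, and continuously so, which makes certificates measurable although the supremum is uncountable.
\<close>

definition support_term :: "'a::real_normed_vector set \<Rightarrow> ('a \<Rightarrow> real) \<Rightarrow> nat \<Rightarrow> ('a \<Rightarrow>\<^sub>L real) \<Rightarrow> real" where
  "support_term X \<psi> N s = (SUP z\<in>X. - blinfun_apply s z - real N * \<psi> z)"

lemma support_term_continuous:
  assumes X: "compact X" "X \<noteq> {}" and \<psi>: "continuous_on X \<psi>"
  shows "continuous_on A (support_term X \<psi> N)"
proof -
  obtain C where C: "\<And>z. z \<in> X \<Longrightarrow> norm z \<le> C" "C > 0"
    using compact_imp_bounded[OF X(1)] bounded_pos by blast
  have bdd: "bdd_above ((\<lambda>z. - blinfun_apply s z - real N * \<psi> z) ` X)" for s
    using X \<psi> by (intro bounded_imp_bdd_above compact_imp_bounded compact_continuous_image continuous_intros) auto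
  have le: "support_term X \<psi> N s \<le> support_term X \<psi> N s' + C * norm (s - s')" for s s'
    unfolding support_term_def
  proof (rule cSUP_least[OF X(2)])
    fix z assume z: "z \<in> X"
    have "- blinfun_apply (s - s') z \<le> norm (s - s') * norm z"
      using norm_blinfun[of "s - s'" z] by simp
    also have "\<dots> \<le> C * norm (s - s')"
      using mult_right_mono[OF C(1)[OF z], of "norm (s - s')"] by (simp add: mult.commute)
    finally have "- blinfun_apply s z - real N * \<psi> z
        \<le> (- blinfun_apply s' z - real N * \<psi> z) + C * norm (s - s')"
      by (simp add: blinfun.diff_left)
    also have "\<dots> \<le> (SUP z\<in>X. - blinfun_apply s' z - real N * \<psi> z) + C * norm (s - s')"
      using z by (intro add_right_mono cSUP_upper bdd)
    finally show "- blinfun_apply s z - real N * \<psi> z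
        \<le> (SUP z\<in>X. - blinfun_apply s' z - real N * \<psi> z) + C * norm (s - s')" .
  qed
  show ?thesis
  proof (rule lipschitz_on_continuous_on[of C], rule lipschitz_onI)
    show "dist (support_term X \<psi> N s) (support_term X \<psi> N s') \<le> C * dist s s'" for s s'
      using le[of s s'] le[of s' s] by (simp add: dist_norm norm_minus_commute abs_le_iff)
  qed (use C in simp)
qed

lemma certificate_eq_support_term:
  assumes X: "compact X" "X \<noteq> {}" and \<psi>: "continuous_on X \<psi>"
  shows "certificate X \<psi> V N t g x
    = ((\<Sum>i=1..N. blinfun_apply (g i) (x i) + \<psi> (x i) + t * V (x (i - 1)) (x i))
        + support_term X \<psi> N (\<Sum>i=1..N. g i)) / real N"
proof -
  let ?c = "\<Sum>i=1..N. blinfun_apply (g i) (x i) + \<psi> (x i) + t * V (x (i - 1)) (x i)"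
  let ?f = "\<lambda>z. - blinfun_apply (\<Sum>i=1..N. g i) z - real N * \<psi> z"
  have eq: "(\<Sum>i=1..N. blinfun_apply (g i) (x i - z) + \<psi> (x i) - \<psi> z + t * V (x (i - 1)) (x i)) = ?c + ?f z" for z
    by (simp add: blinfun.diff_right blinfun.sum_left sum.distrib sum_subtractf)
  have "bdd_above (?f ` X)"
    using X \<psi> by (intro bounded_imp_bdd_above compact_imp_bounded compact_continuous_image continuous_intros) auto
  then have "(SUP z\<in>X. ?c + ?f z) = ?c + (SUP z\<in>X. ?f z)"
    using X(2) by (intro Sup_add_eq) auto
  then show ?thesis
    unfolding certificate_def support_term_def eq by simp
qed

lemma borel_measurable_continuous_on_compose:
  assumes "continuous_on A h" "f \<in> borel_measurable M" "\<And>s. s \<in> space M \<Longrightarrow> f s \<in> A"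
  shows "(\<lambda>s. h (f s)) \<in> borel_measurable M"
proof (rule measurable_compose[OF _ borel_measurable_continuous_on_restrict[OF assms(1)]])
  show "f \<in> M \<rightarrow>\<^sub>M restrict_space borel A"
    using assms(2,3) by (intro measurable_restrict_space2) auto
qed

lemma borel_measurable_blinfun_apply:
  fixes f :: "'s \<Rightarrow> 'a::finite_dim_normed_space \<Rightarrow>\<^sub>L real"
  assumes [measurable]: "f \<in> borel_measurable M" "g \<in> borel_measurable M"
  shows "(\<lambda>s. blinfun_apply (f s) (g s)) \<in> borel_measurable M"
proof -
  have "continuous_on UNIV (\<lambda>z :: ('a \<Rightarrow>\<^sub>L real) \<times> 'a. blinfun_apply (fst z) (snd z))"
    by (intro continuous_intros)
  from borel_measurable_continuous_on_compose[OF this, of "\<lambda>s. (f s, g s)" M] show ?thesis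
    by simp
qed

lemma borel_measurable_certificate:
  fixes x :: "nat \<Rightarrow> 's \<Rightarrow> 'a::finite_dim_normed_space"
  assumes X: "compact X" "X \<noteq> {}" and \<psi>: "continuous_on X \<psi>"
    and x: "\<And>i. i \<in> {1..N} \<Longrightarrow> x i \<in> borel_measurable M"
    and xX: "\<And>i s. i \<in> {1..N} \<Longrightarrow> s \<in> space M \<Longrightarrow> x i s \<in> X"
    and g: "\<And>i. i \<in> {1..N} \<Longrightarrow> g i \<in> borel_measurable M"
    and V: "\<And>i. i \<in> {1..N} \<Longrightarrow> (\<lambda>s. V (x (i - 1) s) (x i s)) \<in> borel_measurable M"
  shows "(\<lambda>s. certificate X \<psi> V N t (\<lambda>i. g i s) (\<lambda>i. x i s)) \<in> borel_measurable M"
proof -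
  have \<psi>x: "(\<lambda>s. \<psi> (x i s)) \<in> borel_measurable M" if "i \<in> {1..N}" for i
    using that by (intro borel_measurable_continuous_on_compose[OF \<psi>] x xX)
  have gx: "(\<lambda>s. blinfun_apply (g i s) (x i s)) \<in> borel_measurable M" if "i \<in> {1..N}" for i
    using that by (intro borel_measurable_blinfun_apply x g)
  have "(\<lambda>s. support_term X \<psi> N (\<Sum>i=1..N. g i s)) \<in> borel_measurable M"
    by (intro borel_measurable_continuous_on_compose[OF support_term_continuous[OF X \<psi>, where A = UNIV]]
        borel_measurable_sum g) auto
  then show ?thesis
    unfolding certificate_eq_support_term[OF X \<psi>]
    by (intro borel_measurable_divide borel_measurable_add borel_measurable_sum borel_measurable_times
        borel_measurable_const \<psi>x gx V)
qed

text \<open>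
  The subgradient selection is continuous only on the set of points where subgradients exist. That set need
  not be Borel, but it contains all values of the scaled base point.
\<close>

lemma borel_measurable_bregman:
  fixes x z :: "'s \<Rightarrow> 'a::finite_dim_normed_space"
  assumes proxy: "proxy_function \<theta> \<theta>'" and R: "R > 0"
    and [measurable]: "x \<in> borel_measurable M" "z \<in> borel_measurable M"
    and x: "\<And>s. s \<in> space M \<Longrightarrow> (x s - x0) /\<^sub>R R \<in> subdiff_domain (cball 0 1) \<theta>"
    and z: "\<And>s. s \<in> space M \<Longrightarrow> norm (z s - x0) \<le> R"
  shows "(\<lambda>s. bregman R x0 \<theta> \<theta>' (x s) (z s)) \<in> borel_measurable M"
proof -
  have ball: "(z s - x0) /\<^sub>R R \<in> cball 0 1" if "s \<in> space M" for s
  proof -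
    have "norm ((z s - x0) /\<^sub>R R) = norm (z s - x0) / R" using R by (simp add: divide_inverse mult.commute)
    then show ?thesis using z[OF that] R by simp
  qed
  have [measurable]: "(\<lambda>s. \<theta> ((z s - x0) /\<^sub>R R)) \<in> borel_measurable M"
    by (rule borel_measurable_continuous_on_compose[OF proxy_continuous[OF proxy] _ ball]) measurable
  have [measurable]: "(\<lambda>s. \<theta> ((x s - x0) /\<^sub>R R)) \<in> borel_measurable M"
    using x by (intro borel_measurable_continuous_on_compose[OF proxy_continuous[OF proxy]])
      (auto simp: subdiff_domain_def)
  have [measurable]: "(\<lambda>s. \<theta>' ((x s - x0) /\<^sub>R R)) \<in> borel_measurable M"
    by (rule borel_measurable_continuous_on_compose[OF proxy_grad_continuous[OF proxy] _ x]) measurable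
  show ?thesis
    unfolding bregman_def scaled_proxy_def scaled_proxy_grad_def
    by (intro borel_measurable_diff borel_measurable_blinfun_apply) measurable
qed

lemma borel_measurable_rho_bar:
  assumes \<sigma>: "\<sigma> > 0" and N: "N \<ge> 1"
    and V: "\<And>i. i \<in> {1..N} \<Longrightarrow> (\<lambda>s. V (x (i - 1) s) (x i s)) \<in> borel_measurable S"
    and V_nonneg: "\<And>i s. i \<in> {1..N} \<Longrightarrow> s \<in> space S \<Longrightarrow> V (x (i - 1) s) (x i s) \<ge> 0"
  shows "(\<lambda>s. rho_bar R \<Theta> \<sigma> M V N \<tau> (\<lambda>i. x i s)) \<in> borel_measurable S"
proof -
  define K where "K = max (real N * \<sigma>\<^sup>2) (M\<^sup>2 * \<tau>)"
  have K: "K > 0" using \<sigma> N by (simp add: K_def less_max_iff_disj)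
  let ?W = "\<lambda>s. \<Sum>i=1..N. V (x (i - 1) s) (x i s)"
  let ?c = "4 * R * sqrt (5 * \<Theta> * K) + 16 * R * max (\<sigma> * sqrt (real N * \<tau>)) (M * \<tau>)"
  have "rho_bar R \<Theta> \<sigma> M V N \<tau> (\<lambda>i. x i s) = ?c + 2 * sqrt (20 * K * ?W s)" if s: "s \<in> space S" for s
  proof -
    have "?W s \<ge> 0" by (intro sum_nonneg V_nonneg s)
    with K have "(INF \<mu>\<in>{0<..}. 20 * K * \<mu> + inverse \<mu> * ?W s) = 2 * sqrt (20 * K * ?W s)"
      by (intro INF_linear_plus_inverse) auto
    moreover have "20 * \<mu> * K = 20 * K * \<mu>" for \<mu> :: real by simp
    ultimately show ?thesis unfolding rho_bar_def K_def[symmetric] by (simp only:)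
  qed
  moreover have "?W \<in> borel_measurable S" by (intro borel_measurable_sum V)
  then have "(\<lambda>s. ?c + 2 * sqrt (20 * K * ?W s)) \<in> borel_measurable S" by measurable
  ultimately show ?thesis by (subst measurable_cong) 
qed

section \<open>The truncated stochastic algorithm\<close>

theorem proposition2:
  fixes X :: "'a::finite_dim_normed_space set"
    and P :: "'w measure"
    and \<Phi> :: "'a \<Rightarrow> 'w \<Rightarrow> real"
    and \<phi> \<psi> F :: "'a \<Rightarrow> real"
    and D\<phi> :: "'a \<Rightarrow> 'a \<Rightarrow>\<^sub>L real"
    and L \<sigma> \<upsilon> R M \<Theta> \<tau> t :: real
    and G :: "'a \<Rightarrow> 'w \<Rightarrow> 'a \<Rightarrow>\<^sub>L real"
    and xbar x0 :: 'a
    and gbar :: "'a \<Rightarrow>\<^sub>L real"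
    and \<theta> :: "'a \<Rightarrow> real"
    and \<theta>' :: "'a \<Rightarrow> 'a \<Rightarrow>\<^sub>L real"
    and V :: "'a \<Rightarrow> 'a \<Rightarrow> real"
    and S :: "'s measure"
    and \<omega> :: "nat \<Rightarrow> 's \<Rightarrow> 'w"
    and N :: nat
    and x :: "nat \<Rightarrow> 's \<Rightarrow> 'a"
    and y :: "nat \<Rightarrow> 's \<Rightarrow> 'a \<Rightarrow>\<^sub>L real"
    and xhat :: "'s \<Rightarrow> 'a"
  assumes X: "X \<noteq> {}" "convex X" "compact X"
    and P: "prob_space P"
    and Phi_integrable: "\<And>z. z \<in> X \<Longrightarrow> integrable P (\<Phi> z)"
    and phi: "\<And>z. z \<in> X \<Longrightarrow> \<phi> z = (\<integral>w. \<Phi> z w \<partial>P)"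
    and phi_convex: "convex_on X \<phi>"
    and phi_deriv: "\<And>z. z \<in> X \<Longrightarrow> (\<phi> has_derivative blinfun_apply (D\<phi> z)) (at z within X)"
    and L: "L > 0"
    and Dphi_lipschitz:
      "\<And>z z'. z \<in> X \<Longrightarrow> z' \<in> X \<Longrightarrow> norm (D\<phi> z' - D\<phi> z) \<le> L * norm (z - z')"
    and psi: "convex_on X \<psi>" "continuous_on X \<psi>"
    and F: "\<And>z. z \<in> X \<Longrightarrow> F z = \<phi> z + \<psi> z"
    and G_measurable:
      "(\<lambda>(z, w). G z w) \<in> borel_measurable (restrict_space borel X \<Otimes>\<^sub>M P)"
    and sigma: "\<sigma> > 0"
    and G_mean: "\<And>z. z \<in> X \<Longrightarrow> integrable P (G z) \<and> (\<integral>w. G z w \<partial>P) = D\<phi> z"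
    and G_variance: "\<And>z. z \<in> X \<Longrightarrow>
        integrable P (\<lambda>w. (norm (G z w - D\<phi> z))\<^sup>2) \<and>
        (\<integral>w. (norm (G z w - D\<phi> z))\<^sup>2 \<partial>P) \<le> \<sigma>\<^sup>2"
    and upsilon: "\<upsilon> \<ge> 0"
    and gbar: "xbar \<in> X" "norm (gbar - D\<phi> xbar) \<le> \<upsilon> * \<sigma>"
    and proxy: "proxy_function \<theta> \<theta>'"
    and Theta: "\<Theta> = proxy_range \<theta>"
    and x0: "x0 \<in> X"
    and R: "R > 0" "\<And>z. z \<in> X \<Longrightarrow> norm (z - x0) \<le> R"
    and M: "M = L * R"
    and V: "V = bregman R x0 \<theta> \<theta>'"
    and S: "prob_space S"
    and omega_indep: "prob_space.indep_vars S (\<lambda>_. P) \<omega> {1..}"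
    and omega_distr: "\<And>i. i \<ge> 1 \<Longrightarrow> distr S P (\<omega> i) = P"
    and N: "N \<ge> 1"
    and x: "search_points S P \<omega> X x0 N x"
    and x_subdiff: "\<And>i s. i < N \<Longrightarrow> s \<in> space S \<Longrightarrow>
        (x i s - x0) /\<^sub>R R \<in> subdiff_domain (cball 0 1) \<theta>"
    and xhat: "\<And>s. s \<in> space S \<Longrightarrow> xhat s = (\<Sum>i=1..N. x i s) /\<^sub>R real N"
    and tau: "\<tau> > 0" "\<upsilon> > 0 \<Longrightarrow> \<tau> \<le> real N / \<upsilon>\<^sup>2"
    and y: "\<And>i s. i \<in> {1..N} \<Longrightarrow> s \<in> space S \<Longrightarrow>
        y i s = truncated_grad L (threshold \<sigma> M \<upsilon> N \<tau>) \<sigma> \<upsilon> xbar gbar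
                  (x (i - 1) s) (G (x (i - 1) s) (\<omega> i s))"
    and t: "t \<ge> L"
  shows "\<P>(s in S. certificate X \<psi> V N t (\<lambda>i. D\<phi> (x (i - 1) s)) (\<lambda>i. x i s)
                  \<le> Delta X \<psi> V R \<Theta> \<sigma> M N \<tau> t (\<lambda>i. y i s) (\<lambda>i. x i s))
           \<ge> 1 - 2 * exp (- \<tau>) \<and>
         \<P>(s in S. F (xhat s) - (INF z\<in>X. F z)
                  \<le> Delta X \<psi> V R \<Theta> \<sigma> M N \<tau> t (\<lambda>i. y i s) (\<lambda>i. x i s))
           \<ge> 1 - 2 * exp (- \<tau>)"
proof -
  interpret P: prob_space P by (rule P)
  interpret S: prob_space S by (rule S)
  interpret noise_sequence S P \<omega>
    using omega_indep omega_distr by unfold_locales auto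
  have xX: "x i s \<in> X" if "i \<le> N" "s \<in> space S" for i s
    using x that by (simp add: search_points_def)
  have x_past: "x i \<in> borel_measurable (past i)" if "i \<le> N" for i
    by (rule search_points_adapted[OF x that])

  \<comment> \<open>The threshold is \<open>l + k\<close>; \<open>b\<close>, \<open>r\<close> and \<open>e\<close> are the constants of \<open>truncated_noise_moments\<close>.\<close>
  define l where "l = max (\<sigma> * sqrt (real N / \<tau>)) M"
  define k where "k = \<upsilon> * \<sigma>"
  define b where "b = 5 * l + 3 * k"
  define r where "r = (2 * l + k) / (l + k)"
  define e where "e = (2 * l + k) / (l + k)\<^sup>2 + 1 / (l + k)"
  have l_pos: "l > 0" and M_le: "M \<le> l" and M_pos: "M > 0"
    using sigma N tau(1) L R(1) by (auto simp: l_def M less_max_iff_disj)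
  have k: "0 \<le> k" "k \<le> l"
  proof -
    show "0 \<le> k" using upsilon sigma by (simp add: k_def)
    show "k \<le> l"
    proof (cases "\<upsilon> = 0")
      case True
      then show ?thesis using l_pos by (simp add: k_def)
    next
      case False
      then have "\<upsilon>\<^sup>2 \<le> real N / \<tau>"
        using tau upsilon by (simp add: field_simps)
      then have "\<upsilon> \<le> sqrt (real N / \<tau>)" by (rule real_le_rsqrt)
      then have "k \<le> \<sigma> * sqrt (real N / \<tau>)"
        using sigma by (simp add: k_def mult.commute)
      then show ?thesis by (simp add: l_def)
    qed
  qed
  have b_pos: "b > 0" using l_pos k by (simp add: b_def)
  have N_sigma: "real N * \<sigma>\<^sup>2 \<le> \<tau> * l\<^sup>2"
  proof -
    have "(\<sigma> * sqrt (real N / \<tau>))\<^sup>2 \<le> l\<^sup>2"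
      using sigma tau by (intro power_mono) (auto simp: l_def)
    then show ?thesis using tau by (simp add: power_mult_distrib field_simps)
  qed

  define \<xi> where "\<xi> z w = truncated_grad L (threshold \<sigma> M \<upsilon> N \<tau>) \<sigma> \<upsilon> xbar gbar z (G z w) - D\<phi> z" for z w
  \<comment> \<open>Bound for the distance of the fallback \<open>gbar\<close> from the gradient at \<open>z\<close>.\<close>
  define a where "a z = L * norm (xbar - z) + k" for z
  have \<xi>_eq: "\<xi> z w = (if norm (G z w - gbar) \<le> a z + (l + k) then G z w else gbar) - D\<phi> z" for z w
    by (simp add: \<xi>_def truncated_grad_def threshold_def a_def l_def k_def add_ac)
  have a: "norm (gbar - D\<phi> z) \<le> a z" "a z \<le> 2 * l + k" if z: "z \<in> X" for z
  proof -
    have "norm (gbar - D\<phi> z) \<le> norm (gbar - D\<phi> xbar) + norm (D\<phi> xbar - D\<phi> z)"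
      using norm_triangle_ineq[of "gbar - D\<phi> xbar" "D\<phi> xbar - D\<phi> z"] by simp
    then show "norm (gbar - D\<phi> z) \<le> a z"
      using gbar(2) Dphi_lipschitz[OF z gbar(1)] by (simp add: a_def k_def norm_minus_commute)
    have "norm (xbar - z) \<le> norm (xbar - x0) + norm (z - x0)"
      using norm_triangle_ineq4[of "xbar - x0" "z - x0"] by simp
    then have "norm (xbar - z) \<le> 2 * R" using R(2)[OF gbar(1)] R(2)[OF z] by linarith
    then have "L * norm (xbar - z) \<le> L * (2 * R)" using L by (intro mult_left_mono) auto
    then show "a z \<le> 2 * l + k" using M_le by (simp add: a_def M)
  qed
  have moments:
    "(\<integral>\<^sup>+w. ennreal (exp (2 / b\<^sup>2 * (norm (\<xi> z w))\<^sup>2)) \<partial>P) \<le> ennreal (exp (32/5 * r\<^sup>2 * \<sigma>\<^sup>2 / b\<^sup>2))"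
    "norm d \<le> 1 \<Longrightarrow> (\<integral>\<^sup>+w. ennreal (exp (2 / b * blinfun_apply (\<xi> z w) d)) \<partial>P)
      \<le> ennreal (exp (2 * e * \<sigma>\<^sup>2 / b + 22/5 * r\<^sup>2 * \<sigma>\<^sup>2 / b\<^sup>2))" if z: "z \<in> X" for z d
  proof -
    note z_facts = conjunct1[OF G_mean[OF z]] conjunct2[OF G_mean[OF z]]
      conjunct1[OF G_variance[OF z]] conjunct2[OF G_variance[OF z]] a[OF z] l_pos k(1)
    show "(\<integral>\<^sup>+w. ennreal (exp (2 / b\<^sup>2 * (norm (\<xi> z w))\<^sup>2)) \<partial>P) \<le> ennreal (exp (32/5 * r\<^sup>2 * \<sigma>\<^sup>2 / b\<^sup>2))"
      unfolding \<xi>_eq b_def r_def by (rule P.truncated_noise_moments(1)[OF z_facts])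
    show "(\<integral>\<^sup>+w. ennreal (exp (2 / b * blinfun_apply (\<xi> z w) d)) \<partial>P)
        \<le> ennreal (exp (2 * e * \<sigma>\<^sup>2 / b + 22/5 * r\<^sup>2 * \<sigma>\<^sup>2 / b\<^sup>2))" if "norm d \<le> 1"
      unfolding \<xi>_eq b_def r_def e_def by (rule P.truncated_noise_moments(2)[OF z_facts that])
  qed

  have D\<phi>_cont: "continuous_on X D\<phi>"
    using Dphi_lipschitz L
    by (intro lipschitz_on_continuous_on[of L] lipschitz_onI) (auto simp: dist_norm norm_minus_commute)
  have [measurable]: "D\<phi> \<in> borel_measurable (restrict_space borel X)"
    by (rule borel_measurable_continuous_on_restrict[OF D\<phi>_cont])
  have id_X [measurable]: "(\<lambda>z. z) \<in> borel_measurable (restrict_space borel X)"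
    by (intro measurable_restrict_space1) simp
  have \<xi>_measurable [measurable]: "(\<lambda>p. \<xi> (fst p) (snd p)) \<in> borel_measurable (restrict_space borel X \<Otimes>\<^sub>M P)"
  proof -
    have [measurable]: "(\<lambda>p. G (fst p) (snd p)) \<in> borel_measurable (restrict_space borel X \<Otimes>\<^sub>M P)"
      using G_measurable by (simp add: case_prod_beta')
    have [measurable]: "fst \<in> borel_measurable (restrict_space borel X \<Otimes>\<^sub>M P)"
      using measurable_compose[OF measurable_fst id_X] by simp
    show ?thesis unfolding \<xi>_eq a_def by measurable
  qed
  have x_past_X [measurable (raw)]: "x i \<in> past i \<rightarrow>\<^sub>M restrict_space borel X" if "i \<le> N" for i
    using x_past[OF that] xX[OF that] by (intro measurable_restrict_space2) auto
  have \<xi>_past: "(\<lambda>s. \<xi> (x (j - 1) s) (\<omega> j s)) \<in> borel_measurable (past i)" if "1 \<le> j" "j \<le> i" "i \<le> N" for i j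
  proof -
    have "(\<lambda>s. (x (j - 1) s, \<omega> j s)) \<in> past i \<rightarrow>\<^sub>M restrict_space borel X \<Otimes>\<^sub>M P"
      using that by (intro measurable_Pair past_mono[OF x_past_X] noise_past) auto
    from measurable_compose[OF this \<xi>_measurable] show ?thesis by simp
  qed

  \<comment> \<open>Dual averaging on the noise. The step \<open>\<eta>\<close> balances the two terms of the regret bound for
    \<open>\<Sum>\<^sub>i \<parallel>\<xi>\<^sub>i\<parallel>\<^sup>2 = 40 \<tau> l\<^sup>2\<close>, and has to be deterministic for \<open>v i\<close> to be a function of the past.\<close>
  define \<eta> where "\<eta> = sqrt (proxy_range \<theta> / (20 * (\<tau> * l\<^sup>2)))"
  define v where "v i s = mirror_map \<theta> (\<eta> *\<^sub>R (\<Sum>j=1..i. \<xi> (x (j - 1) s) (\<omega> j s)))" for i s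
  have v_ball: "norm (v i s) \<le> 1" for i s
    unfolding v_def by (rule mirror_map_in_cball[OF proxy])
  have v_past: "v i \<in> past i \<rightarrow>\<^sub>M restrict_space borel (cball (0::'a) 1)" if "i \<le> N" for i
  proof (rule measurable_restrict_space2)
    have "(\<lambda>s. \<eta> *\<^sub>R (\<Sum>j=1..i. \<xi> (x (j - 1) s) (\<omega> j s))) \<in> borel_measurable (past i)"
      using that by (intro borel_measurable_scaleR borel_measurable_sum \<xi>_past) auto
    then show "v i \<in> borel_measurable (past i)"
      unfolding v_def by (rule borel_measurable_continuous_on_compose[OF mirror_map_continuous[OF proxy, of UNIV]]) simp
  qed (use v_ball in auto)

  \<comment> \<open>The two families of summands, as functions of a past-measurable point and a fresh sample, scaled to
    exponents of modulus at most 2. The direction \<open>dir\<close> has norm at most 1, since both of its points lie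
    in the unit ball.\<close>
  define f1 where "f1 p = 2 / b\<^sup>2 * (norm (\<xi> (fst p) (snd p)))\<^sup>2" for p
  define dir where "dir q = (snd q - (fst q - x0) /\<^sub>R R) /\<^sub>R 2" for q :: "'a \<times> 'a"
  define f2 where "f2 p = 2 / b * blinfun_apply (\<xi> (fst (fst p)) (snd p)) (dir (fst p))" for p
  define c1 where "c1 = 32/5 * r\<^sup>2 * \<sigma>\<^sup>2 / b\<^sup>2"
  define c2 where "c2 = 2 * e * \<sigma>\<^sup>2 / b + 22/5 * r\<^sup>2 * \<sigma>\<^sup>2 / b\<^sup>2"
  define E1 where "E1 = {s \<in> space S. (\<Sum>i<N. f1 (x i s, \<omega> (Suc i) s)) > real N * c1 + \<tau>}"
  define E2 where "E2 = {s \<in> space S. (\<Sum>i<N. f2 ((x i s, v i s), \<omega> (Suc i) s)) > real N * c2 + \<tau>}"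
  have f1: "f1 \<in> borel_measurable (restrict_space borel X \<Otimes>\<^sub>M P)"
    unfolding f1_def by measurable
  let ?K = "restrict_space borel X \<Otimes>\<^sub>M restrict_space borel (cball (0::'a) 1)"
  have f2: "f2 \<in> borel_measurable (?K \<Otimes>\<^sub>M P)"
  proof -
    have id_ball: "(\<lambda>z. z) \<in> borel_measurable (restrict_space borel (cball (0::'a) 1))"
      by (intro measurable_restrict_space1) simp
    have "(\<lambda>p. fst (fst p)) \<in> ?K \<Otimes>\<^sub>M P \<rightarrow>\<^sub>M restrict_space borel X"
      "(\<lambda>p. snd (fst p)) \<in> ?K \<Otimes>\<^sub>M P \<rightarrow>\<^sub>M restrict_space borel (cball (0::'a) 1)" by measurable
    from measurable_compose[OF this(1) id_X] measurable_compose[OF this(2) id_ball]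
    have [measurable]: "(\<lambda>p. fst (fst p)) \<in> borel_measurable (?K \<Otimes>\<^sub>M P)"
      "(\<lambda>p. snd (fst p)) \<in> borel_measurable (?K \<Otimes>\<^sub>M P)"
      by simp_all
    have "(\<lambda>p. dir (fst p)) \<in> borel_measurable (?K \<Otimes>\<^sub>M P)"
      unfolding dir_def by measurable
    moreover have "(\<lambda>p. \<xi> (fst (fst p)) (snd p)) \<in> borel_measurable (?K \<Otimes>\<^sub>M P)"
    proof -
      have "(\<lambda>p. (fst (fst p), snd p)) \<in> ?K \<Otimes>\<^sub>M P \<rightarrow>\<^sub>M restrict_space borel X \<Otimes>\<^sub>M P" by measurable
      from measurable_compose[OF this \<xi>_measurable] show ?thesis by simp
    qed
    ultimately show ?thesis
      unfolding f2_def by (intro borel_measurable_times borel_measurable_blinfun_apply) auto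
  qed
  have E1_prob: "S.prob E1 \<le> exp (- \<tau>)"
    unfolding E1_def
  proof (rule adapted_sum_tail[OF f1])
    fix i s assume "i < N" "s \<in> space S"
    then show "(\<integral>\<^sup>+w. ennreal (exp (f1 (x i s, w))) \<partial>P) \<le> ennreal (exp c1)"
      using moments(1)[OF xX] by (simp add: f1_def c1_def)
  qed (use x_past_X in auto)
  have E2_prob: "S.prob E2 \<le> exp (- \<tau>)"
    unfolding E2_def
  proof (rule adapted_sum_tail[where T = "\<lambda>i s. (x i s, v i s)", OF f2])
    fix i s assume i: "i < N" and s: "s \<in> space S"
    have xi: "x i s \<in> X" using xX i s by simp
    have "norm (v i s - (x i s - x0) /\<^sub>R R) \<le> norm (v i s) + norm ((x i s - x0) /\<^sub>R R)"
      by (rule norm_triangle_ineq4)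
    also have "norm ((x i s - x0) /\<^sub>R R) = norm (x i s - x0) / R" using R(1) by (simp add: divide_inverse mult.commute)
    also have "\<dots> \<le> 1" using R xi by simp
    finally have "norm (dir (x i s, v i s)) \<le> 1" using v_ball[of i s] by (simp add: dir_def)
    from moments(2)[OF xi this]
    show "(\<integral>\<^sup>+w. ennreal (exp (f2 ((x i s, v i s), w))) \<partial>P) \<le> ennreal (exp c2)"
      by (simp add: f2_def c2_def)
  qed (use x_past_X v_past in auto)

  have V_growth: "(norm (x i s - x (i - 1) s))\<^sup>2 / 2 \<le> V (x (i - 1) s) (x i s)" if "i \<in> {1..N}" "s \<in> space S" for i s
    unfolding V using that xX by (intro bregman_growth[OF proxy R(1)] x_subdiff R(2)) auto
  have y_noise: "y i s - D\<phi> (x (i - 1) s) = \<xi> (x (i - 1) s) (\<omega> i s)" if "i \<in> {1..N}" "s \<in> space S" for i s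
    using y[OF that] by (simp add: \<xi>_def)

  let ?exact = "\<lambda>s. certificate X \<psi> V N t (\<lambda>i. D\<phi> (x (i - 1) s)) (\<lambda>i. x i s)"
  let ?\<Delta> = "\<lambda>s. Delta X \<psi> V R \<Theta> \<sigma> M N \<tau> t (\<lambda>i. y i s) (\<lambda>i. x i s)"
  let ?gap = "\<lambda>s. F (xhat s) - (INF z\<in>X. F z)"
  have shift: "(\<Sum>i<N. h (Suc i)) = (\<Sum>i=1..N. h i)" for h :: "nat \<Rightarrow> real"
    by (simp add: sum.atLeast1_atMost_eq)
  have exact_le: "?exact s \<le> ?\<Delta> s" if s: "s \<in> space S" "s \<notin> E1" "s \<notin> E2" for s
  proof -
    have square: "(\<Sum>i=1..N. (norm (\<xi> (x (i - 1) s) (\<omega> i s)))\<^sup>2) \<le> 40 * (\<tau> * l\<^sup>2)" (is "?Q \<le> _")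
    proof -
      have "(\<Sum>i<N. f1 (x i s, \<omega> (Suc i) s)) = 2 / b\<^sup>2 * ?Q"
        using shift[of "\<lambda>i. 2 / b\<^sup>2 * (norm (\<xi> (x (i - 1) s) (\<omega> i s)))\<^sup>2"]
        by (simp add: f1_def sum_distrib_left)
      then have "2 / b\<^sup>2 * ?Q \<le> real N * c1 + \<tau>" using s by (auto simp: E1_def)
      then have "?Q \<le> b\<^sup>2 / 2 * (real N * c1 + \<tau>)" using b_pos by (simp add: field_simps)
      also have "\<dots> = 16/5 * r\<^sup>2 * (real N * \<sigma>\<^sup>2) + \<tau> * (b\<^sup>2 / 2)"
        using b_pos by (simp add: c1_def field_simps)
      also have "\<dots> \<le> 16/5 * r\<^sup>2 * (\<tau> * l\<^sup>2) + \<tau> * (b\<^sup>2 / 2)"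
        using N_sigma by (intro add_right_mono mult_left_mono) auto
      also have "\<dots> = \<tau> * (b\<^sup>2 / 2 + 16/5 * r\<^sup>2 * l\<^sup>2)" by (simp add: algebra_simps)
      also have "\<dots> \<le> \<tau> * (40 * l\<^sup>2)"
        using truncation_constant_square[OF l_pos k] tau unfolding b_def r_def by (intro mult_left_mono) auto
      finally show ?thesis by simp
    qed
    have linear: "(\<Sum>i=1..N. blinfun_apply (\<xi> (x (i - 1) s) (\<omega> i s)) ((v (i - 1) s - (x (i - 1) s - x0) /\<^sub>R R) /\<^sub>R 2))
        \<le> 8 * \<tau> * l" (is "?Q \<le> _")
    proof -
      have "(\<Sum>i<N. f2 ((x i s, v i s), \<omega> (Suc i) s)) = 2 / b * ?Q"
        using shift[of "\<lambda>i. 2 / b * blinfun_apply (\<xi> (x (i - 1) s) (\<omega> i s)) (dir (x (i - 1) s, v (i - 1) s))"]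
        by (simp add: f2_def sum_distrib_left dir_def)
      then have "2 / b * ?Q \<le> real N * c2 + \<tau>" using s by (auto simp: E2_def)
      then have "?Q \<le> b / 2 * (real N * c2 + \<tau>)" using b_pos by (simp add: field_simps)
      also have "\<dots> = (e + 11/5 * r\<^sup>2 / b) * (real N * \<sigma>\<^sup>2) + \<tau> * (b / 2)"
        using b_pos by (simp add: c2_def field_simps power2_eq_square)
      also have "\<dots> \<le> (e + 11/5 * r\<^sup>2 / b) * (\<tau> * l\<^sup>2) + \<tau> * (b / 2)"
        using N_sigma b_pos l_pos k by (intro add_right_mono mult_left_mono) (auto simp: e_def)
      also have "\<dots> = \<tau> * (b / 2 + e * l\<^sup>2 + 11/5 * r\<^sup>2 * l\<^sup>2 / b)" by (simp add: algebra_simps)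
      also have "\<dots> \<le> \<tau> * (8 * l)"
        using truncation_constant_linear[OF l_pos k] tau unfolding b_def r_def e_def by (intro mult_left_mono) auto
      finally show ?thesis by simp
    qed
    have "?exact s \<le> certificate X \<psi> V N t (\<lambda>i. y i s) (\<lambda>i. x i s) + rho_bar R \<Theta> \<sigma> M V N \<tau> (\<lambda>i. x i s) / real N"
    proof (rule certificate_compare[OF X(3,1) psi(2)])
      fix z assume z: "z \<in> X"
      have "(\<Sum>i=1..N. blinfun_apply (D\<phi> (x (i - 1) s) - y i s) (x i s - z))
          = (\<Sum>i=1..N. blinfun_apply (\<xi> (x (i - 1) s) (\<omega> i s)) (z - x i s))"
      proof (rule sum.cong)
        fix i assume i: "i \<in> {1..N}"
        show "blinfun_apply (D\<phi> (x (i - 1) s) - y i s) (x i s - z) = blinfun_apply (\<xi> (x (i - 1) s) (\<omega> i s)) (z - x i s)"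
          unfolding y_noise[OF i s(1), symmetric] by (simp add: blinfun.diff_left blinfun.diff_right)
      qed simp
      also have "\<dots> \<le> rho_bar R (proxy_range \<theta>) \<sigma> M V N \<tau> (\<lambda>i. x i s)"
      proof (rule linear_error_le_rho_bar[OF proxy R(1) tau(1) sigma _ N R(2)[OF z]])
        show "0 \<le> M" using M_pos by simp
        show "(norm (x i s - x (i - 1) s))\<^sup>2 / 2 \<le> V (x (i - 1) s) (x i s)" if "i \<in> {1..N}" for i
          by (rule V_growth[OF that s(1)])
      qed (rule square[unfolded l_def] linear[unfolded v_def \<eta>_def l_def])+
      finally show "(\<Sum>i=1..N. blinfun_apply (D\<phi> (x (i - 1) s) - y i s) (x i s - z)) \<le> rho_bar R \<Theta> \<sigma> M V N \<tau> (\<lambda>i. x i s)"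
        by (simp add: Theta)
    qed
    then show ?thesis by (simp add: Delta_def)
  qed
  have gap_le: "?gap s \<le> ?exact s" if s: "s \<in> space S" for s
    unfolding xhat[OF s]
  proof (rule certificate_bounds_gap[OF X phi_convex phi_deriv Dphi_lipschitz psi N _ _ less_imp_le[OF L] t F])
    show "x i s \<in> X" if "i \<le> N" for i by (rule xX[OF that s])
    show "(norm (x i s - x (i - 1) s))\<^sup>2 / 2 \<le> V (x (i - 1) s) (x i s)" if "i \<in> {1..N}" for i
      by (rule V_growth[OF that s])
  qed

  have x_meas: "x i \<in> borel_measurable S" if "i \<le> N" for i
    by (rule past_measurable[OF x_past[OF that]])
  have \<phi>_cont: "continuous_on X \<phi>"
    using has_derivative_continuous[OF phi_deriv] by (simp add: continuous_on_eq_continuous_within)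
  have V_meas: "(\<lambda>s. V (x (i - 1) s) (x i s)) \<in> borel_measurable S" if "i \<in> {1..N}" for i
    unfolding V
  proof (rule borel_measurable_bregman[OF proxy R(1)])
    show "(x (i - 1) s - x0) /\<^sub>R R \<in> subdiff_domain (cball 0 1) \<theta>" if "s \<in> space S" for s
      using \<open>i \<in> {1..N}\<close> that by (intro x_subdiff) auto
    show "norm (x i s - x0) \<le> R" if "s \<in> space S" for s
      using \<open>i \<in> {1..N}\<close> that by (intro R(2) xX) auto
  qed (use that in \<open>auto intro: x_meas\<close>)
  have D\<phi>_meas: "(\<lambda>s. D\<phi> (x (i - 1) s)) \<in> borel_measurable S" if "i \<in> {1..N}" for i
    using that xX by (intro borel_measurable_continuous_on_compose[OF D\<phi>_cont] x_meas) auto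
  have y_meas: "y i \<in> borel_measurable S" if i: "i \<in> {1..N}" for i
  proof -
    have "(\<lambda>s. \<xi> (x (i - 1) s) (\<omega> i s) + D\<phi> (x (i - 1) s)) \<in> borel_measurable S"
      using i by (intro borel_measurable_add D\<phi>_meas past_measurable[OF \<xi>_past[of i i]]) auto
    moreover have "y i s = \<xi> (x (i - 1) s) (\<omega> i s) + D\<phi> (x (i - 1) s)" if "s \<in> space S" for s
      using y_noise[OF i that] by (simp add: algebra_simps)
    ultimately show ?thesis by (subst measurable_cong) auto
  qed
  have \<Delta>_meas [measurable]: "?\<Delta> \<in> borel_measurable S"
  proof -
    have "V (x (i - 1) s) (x i s) \<ge> 0" if "i \<in> {1..N}" "s \<in> space S" for i s
      using V_growth[OF that] by (meson order_trans zero_le_power2 divide_nonneg_pos zero_less_numeral)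
    then have "(\<lambda>s. rho_bar R \<Theta> \<sigma> M V N \<tau> (\<lambda>i. x i s)) \<in> borel_measurable S"
      by (intro borel_measurable_rho_bar sigma N V_meas)
    moreover have "(\<lambda>s. certificate X \<psi> V N t (\<lambda>i. y i s) (\<lambda>i. x i s)) \<in> borel_measurable S"
      using xX by (intro borel_measurable_certificate X psi x_meas y_meas V_meas) auto
    ultimately show ?thesis unfolding Delta_def by measurable
  qed
  have exact_meas [measurable]: "?exact \<in> borel_measurable S"
    using xX by (intro borel_measurable_certificate X psi x_meas D\<phi>_meas V_meas) auto
  have gap_meas [measurable]: "?gap \<in> borel_measurable S"
  proof -
    have xhat_X: "xhat s \<in> X" if s: "s \<in> space S" for s
    proof -
      have "xhat s = (\<Sum>i\<in>{1..N}. (1 / real N) *\<^sub>R x i s)"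
        using xhat[OF s] by (simp add: scaleR_sum_right inverse_eq_divide)
      then show ?thesis using xX[OF _ s] N by (auto intro!: convex_sum X)
    qed
    have "xhat \<in> borel_measurable S"
      using x_meas by (subst measurable_cong[OF xhat]) (auto intro!: borel_measurable_scaleR borel_measurable_sum)
    then have "(\<lambda>s. \<phi> (xhat s) + \<psi> (xhat s)) \<in> borel_measurable S"
      using xhat_X by (intro borel_measurable_add borel_measurable_continuous_on_compose[OF \<phi>_cont]
          borel_measurable_continuous_on_compose[OF psi(2)])
    then have "(\<lambda>s. F (xhat s)) \<in> borel_measurable S"
      by (subst measurable_cong[OF F[OF xhat_X]]) auto
    then show ?thesis by simp
  qed
  have E_meas: "E1 \<in> sets S" "E2 \<in> sets S"
  proof -
    have [measurable]: "(\<lambda>s. f1 (x i s, \<omega> (Suc i) s)) \<in> borel_measurable S"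
      "(\<lambda>s. f2 ((x i s, v i s), \<omega> (Suc i) s)) \<in> borel_measurable S" if "i < N" for i
    proof -
      have [measurable]: "x i \<in> S \<rightarrow>\<^sub>M restrict_space borel X" "v i \<in> S \<rightarrow>\<^sub>M restrict_space borel (cball (0::'a) 1)"
        "\<omega> (Suc i) \<in> S \<rightarrow>\<^sub>M P"
        using that by (auto intro: past_measurable[OF x_past_X] past_measurable[OF v_past] noise_measurable)
      show "(\<lambda>s. f1 (x i s, \<omega> (Suc i) s)) \<in> borel_measurable S"
        by (rule measurable_compose[OF _ f1]) measurable
      show "(\<lambda>s. f2 ((x i s, v i s), \<omega> (Suc i) s)) \<in> borel_measurable S"
        by (rule measurable_compose[OF _ f2]) measurable
    qed
    show "E1 \<in> sets S" "E2 \<in> sets S" unfolding E1_def E2_def by measurable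
  qed
  have conclude: "1 - 2 * exp (- \<tau>) \<le> S.prob A" if A: "A \<in> sets S" "space S - E1 - E2 \<subseteq> A" for A
  proof -
    have "1 = S.prob (space S)" by (simp add: S.prob_space)
    also have "\<dots> \<le> S.prob ((A \<union> E1) \<union> E2)"
      using A E_meas by (intro S.finite_measure_mono) auto
    also have "\<dots> \<le> S.prob (A \<union> E1) + S.prob E2" using A E_meas by (intro measure_Un_le) auto
    also have "S.prob (A \<union> E1) \<le> S.prob A + S.prob E1" using A E_meas by (intro measure_Un_le) auto
    finally show ?thesis using E1_prob E2_prob by linarith
  qed
  have "{s \<in> space S. ?exact s \<le> ?\<Delta> s} \<in> sets S" "{s \<in> space S. ?gap s \<le> ?\<Delta> s} \<in> sets S"
    by measurable
  moreover have "space S - E1 - E2 \<subseteq> {s \<in> space S. ?exact s \<le> ?\<Delta> s}"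
    using exact_le by blast
  moreover have "space S - E1 - E2 \<subseteq> {s \<in> space S. ?gap s \<le> ?\<Delta> s}"
    using order_trans[OF gap_le exact_le] by blast
  ultimately show ?thesis
    by (intro conjI conclude)
qed

end
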